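(* Let $X\in L^2[0,1]$ and $Z\in\mathbb{R}$ be random variables. Assume that $\mathbb{E}|Z|<\infty$ and $\mathbb{E}(Z)=0$. (A) The following statements are equivalent: 1. $\mathbb{E}(Z\mid X)=0$ a.s. 2. $\mathbb{E}(Z\mid\langle X,\beta\rangle)=0$ a.s. for all $\beta\in L^2[0,1]$ with $\|\beta\|_{L^2}=1$. 3. For any integer $p\ge 1$, $\mathbb{E}(Z\mid\langle X,\gamma\rangle)=0$ a.s. for all $\gamma\in\mathcal{S}^p$. 4. For any integer $p\ge 1$, $\mathbb{E}(Z\mid X^{(p)})=0$ a.s. (B) Suppose in addition that for any positive real number $s$, $\mathbb{E}(|Z|\exp\{s\|X\|_{L^2}\})<\infty$. If $\mathbb{P}[\mathbb{E}(Z\mid X)=0]<1$, then there exists a positive integer $p_0\ge 1$ such that for any integer $p>p_0$, the set $$\{\gamma\in\mathcal{S}^p:\ \mathbb{E}(Z\mid\langle X,\gamma\rangle)=0\ \text{a.s.}\}$$ has Lebesgue measure zero on the unit hypersphere $\mathcal{S}^p$ and is not dense.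
   Context: $L^2[0,1]$ is the space of square-integrable real-valued functions on $[0,1]$ with inner product $\langle X_1,X_2\rangle=\int_0^1X_1(t)X_2(t)\,dt$ and norm $\|\cdot\|_{L^2}$. $\mathcal{S}^p=\{\gamma\in\mathbb{R}^p:\|\gamma\|=1\}$ is the unit sphere of $\mathbb{R}^p$. $\mathcal{R}=\{\rho_1,\rho_2,\dots\}$ is an arbitrary fixed orthonormal basis of $L^2[0,1]$; $x_j=\langle X,\rho_j\rangle$, and $X^{(p)}=\sum_{j=1}^p x_j\rho_j$, also identified with the random vector $(x_1,\dots,x_p)$. A vector $\gamma=(\gamma_1,\dots,\gamma_p)\in\mathbb{R}^p$ is identified with $\sum_{j=1}^p\gamma_j\rho_j\in L^2[0,1]$, so that $\langle X,\gamma\rangle=\sum_{j=1}^p x_j\gamma_j$. *)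

theory Defs
  imports "HOL-Probability.Probability"
begin

definition square_integrable :: "(real \<Rightarrow> real) \<Rightarrow> bool" where
  "square_integrable f \<longleftrightarrow>
     f \<in> borel_measurable (lebesgue_on {0..1}) \<and> integrable (lebesgue_on {0..1}) (\<lambda>t. (f t)\<^sup>2)"

definition L2_eq :: "(real \<Rightarrow> real) \<Rightarrow> (real \<Rightarrow> real) \<Rightarrow> bool" where
  "L2_eq f g \<longleftrightarrow> square_integrable f \<and> square_integrable g \<and>
     (AE t in lebesgue_on {0..1}. f t = g t)"

lemma square_integrable_zero: "square_integrable (\<lambda>_. 0)"
  by (simp add: square_integrable_def)

lemma square_integrable_mult:
  assumes "square_integrable f" "square_integrable g"
  shows "integrable (lebesgue_on {0..1}) (\<lambda>t. f t * g t)"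
proof (rule Bochner_Integration.integrable_bound)
  show "integrable (lebesgue_on {0..1}) (\<lambda>t. (f t)\<^sup>2 + (g t)\<^sup>2)"
    using assms by (simp add: square_integrable_def)
  show "(\<lambda>t. f t * g t) \<in> borel_measurable (lebesgue_on {0..1})"
    using assms by (intro borel_measurable_times) (simp_all add: square_integrable_def)
  have "\<bar>a * b\<bar> \<le> \<bar>a\<^sup>2 + b\<^sup>2\<bar>" for a b :: real
    using sum_squares_bound[of "\<bar>a\<bar>" "\<bar>b\<bar>"] abs_ge_zero[of "a * b"]
    by (simp only: abs_mult power2_abs mult.assoc)
  then show "AE t in lebesgue_on {0..1}. norm (f t * g t) \<le> norm ((f t)\<^sup>2 + (g t)\<^sup>2)"
    by simp
qed

lemma square_integrable_add:
  assumes "square_integrable f" "square_integrable g"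
  shows "square_integrable (\<lambda>t. f t + g t)"
  using assms square_integrable_mult[OF assms]
  by (auto simp: square_integrable_def power2_sum mult.assoc)

lemma square_integrable_scale:
  "square_integrable f \<Longrightarrow> square_integrable (\<lambda>t. c * f t)"
  by (auto simp: square_integrable_def power_mult_distrib)

lemma square_integrable_minus: "square_integrable f \<Longrightarrow> square_integrable (\<lambda>t. - f t)"
  using square_integrable_scale[of f "-1"] by simp

lemma square_integrable_diff:
  "square_integrable f \<Longrightarrow> square_integrable g \<Longrightarrow> square_integrable (\<lambda>t. f t - g t)"
  using square_integrable_add[of f "\<lambda>t. - g t"] square_integrable_minus[of g] by simp

quotient_type L2_unit = "real \<Rightarrow> real" / partial: L2_eq
proof (rule part_equivpI)
  show "\<exists>f. L2_eq f f"
    using square_integrable_zero by (auto simp: L2_eq_def)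
  show "symp L2_eq"
    by (auto simp: symp_def L2_eq_def)
  show "transp L2_eq"
    by (auto simp: transp_def L2_eq_def)
qed

instantiation L2_unit :: real_inner
begin

lift_definition zero_L2_unit :: L2_unit is "\<lambda>_. 0"
  by (simp add: L2_eq_def square_integrable_zero)

lift_definition plus_L2_unit :: "L2_unit \<Rightarrow> L2_unit \<Rightarrow> L2_unit" is "\<lambda>f g t. f t + g t"
  by (auto simp: L2_eq_def square_integrable_add)

lift_definition minus_L2_unit :: "L2_unit \<Rightarrow> L2_unit \<Rightarrow> L2_unit" is "\<lambda>f g t. f t - g t"
  by (auto simp: L2_eq_def square_integrable_diff)

lift_definition uminus_L2_unit :: "L2_unit \<Rightarrow> L2_unit" is "\<lambda>f t. - f t"
  by (auto simp: L2_eq_def square_integrable_minus)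

lift_definition scaleR_L2_unit :: "real \<Rightarrow> L2_unit \<Rightarrow> L2_unit" is "\<lambda>c f t. c * f t"
  by (auto simp: L2_eq_def square_integrable_scale)

lift_definition inner_L2_unit :: "L2_unit \<Rightarrow> L2_unit \<Rightarrow> real"
  is "\<lambda>f g. integral\<^sup>L (lebesgue_on {0..1}) (\<lambda>t. f t * g t)"
  by (intro integral_cong_AE) (auto simp: L2_eq_def square_integrable_def)

definition norm_L2_unit :: "L2_unit \<Rightarrow> real" where
  "norm_L2_unit x = sqrt (inner x x)"

definition dist_L2_unit :: "L2_unit \<Rightarrow> L2_unit \<Rightarrow> real" where
  "dist_L2_unit x y = norm (x - y)"

definition sgn_L2_unit :: "L2_unit \<Rightarrow> L2_unit" where
  "sgn_L2_unit x = inverse (norm x) *\<^sub>R x"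

definition uniformity_L2_unit :: "(L2_unit \<times> L2_unit) filter" where
  "uniformity_L2_unit = (INF e\<in>{0<..}. principal {(x, y). dist x y < e})"

definition open_L2_unit :: "L2_unit set \<Rightarrow> bool" where
  "open_L2_unit U \<longleftrightarrow> (\<forall>x\<in>U. eventually (\<lambda>(x', y). x' = x \<longrightarrow> y \<in> U) uniformity)"

instance
proof
  fix x y z :: L2_unit and a b :: real
  show "x + y + z = x + (y + z)"
    by transfer (auto simp: L2_eq_def add.assoc intro!: square_integrable_add)
  show "x + y = y + x"
    by transfer (auto simp: L2_eq_def add.commute intro!: square_integrable_add)
  show "0 + x = x"
    by transfer (auto simp: L2_eq_def)
  show "- x + x = 0"
    by transfer (auto simp: L2_eq_def square_integrable_zero)
  show "x - y = x + - y"
    by transfer (auto simp: L2_eq_def square_integrable_diff)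
  show "a *\<^sub>R (x + y) = a *\<^sub>R x + a *\<^sub>R y"
    by transfer
      (auto simp: L2_eq_def distrib_left intro!: square_integrable_add square_integrable_scale)
  show "(a + b) *\<^sub>R x = a *\<^sub>R x + b *\<^sub>R x"
    by transfer
      (auto simp: L2_eq_def distrib_right intro!: square_integrable_add square_integrable_scale)
  show "a *\<^sub>R b *\<^sub>R x = (a * b) *\<^sub>R x"
    by transfer (auto simp: L2_eq_def mult.assoc intro!: square_integrable_scale)
  show "1 *\<^sub>R x = x"
    by transfer (auto simp: L2_eq_def)
  show "inner x y = inner y x"
    by transfer (simp add: mult.commute)
  show "inner (x + y) z = inner x z + inner y z"
    by transfer (auto simp: L2_eq_def distrib_right square_integrable_mult)
  show "inner (a *\<^sub>R x) y = a * inner x y"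
    by transfer (simp add: mult.assoc)
  show "0 \<le> inner x x"
    by transfer simp
  show "inner x x = 0 \<longleftrightarrow> x = 0"
  proof transfer
    fix f assume "L2_eq f f"
    then have f: "square_integrable f"
      by (simp add: L2_eq_def)
    have "integral\<^sup>L (lebesgue_on {0..1}) (\<lambda>t. f t * f t) = 0 \<longleftrightarrow>
          (AE t in lebesgue_on {0..1}. f t * f t = 0)"
      using square_integrable_mult[OF f f] by (intro integral_nonneg_eq_0_iff_AE) auto
    then show "integral\<^sup>L (lebesgue_on {0..1}) (\<lambda>t. f t * f t) = 0 \<longleftrightarrow> L2_eq f (\<lambda>_. 0)"
      using f by (simp add: L2_eq_def square_integrable_zero)
  qed
  show "norm x = sqrt (inner x x)"
    by (fact norm_L2_unit_def)
  show "dist x y = norm (x - y)"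
    by (fact dist_L2_unit_def)
  show "sgn x = inverse (norm x) *\<^sub>R x"
    by (fact sgn_L2_unit_def)
  show "(uniformity :: (L2_unit \<times> L2_unit) filter) = (INF e\<in>{0<..}. principal {(x, y). dist x y < e})"
    by (fact uniformity_L2_unit_def)
  show "open U \<longleftrightarrow> (\<forall>x\<in>U. eventually (\<lambda>(x', y). x' = x \<longrightarrow> y \<in> U) uniformity)" for U :: "L2_unit set"
    by (fact open_L2_unit_def)
qed

end

definition orthonormal_basis :: "(nat \<Rightarrow> 'a::real_inner) \<Rightarrow> bool" where
  "orthonormal_basis \<rho> \<longleftrightarrow>
     (\<forall>i j. inner (\<rho> i) (\<rho> j) = (if i = j then 1 else 0)) \<and> closure (span (range \<rho>)) = UNIV"

text \<open>
  Indices start at \<open>0\<close>: the first \<open>p\<close> basis vectors are \<open>\<rho> 0, \<dots>, \<rho> (p - 1)\<close>, and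
  \<open>\<real>\<^sup>p\<close> is the set \<open>{..<p} \<rightarrow>\<^sub>E UNIV\<close>, which underlies both the product measure and the product
  topology used below.
\<close>

definition truncation :: "(nat \<Rightarrow> 'a::real_inner) \<Rightarrow> nat \<Rightarrow> 'a \<Rightarrow> 'a" where
  "truncation \<rho> p x = (\<Sum>j<p. inner x (\<rho> j) *\<^sub>R \<rho> j)"

definition from_coords :: "(nat \<Rightarrow> 'a::real_inner) \<Rightarrow> nat \<Rightarrow> (nat \<Rightarrow> real) \<Rightarrow> 'a" where
  "from_coords \<rho> p \<gamma> = (\<Sum>j<p. \<gamma> j *\<^sub>R \<rho> j)"

definition vec_norm :: "nat \<Rightarrow> (nat \<Rightarrow> real) \<Rightarrow> real" where
  "vec_norm p x = sqrt (\<Sum>j<p. (x j)\<^sup>2)"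

definition unit_sphere :: "nat \<Rightarrow> (nat \<Rightarrow> real) set" where
  "unit_sphere p = {\<gamma> \<in> {..<p} \<rightarrow>\<^sub>E UNIV. vec_norm p \<gamma> = 1}"

definition punctured_ball :: "nat \<Rightarrow> (nat \<Rightarrow> real) set" where
  "punctured_ball p = {x \<in> {..<p} \<rightarrow>\<^sub>E UNIV. 0 < vec_norm p x \<and> vec_norm p x \<le> 1}"

definition radial_projection :: "nat \<Rightarrow> (nat \<Rightarrow> real) \<Rightarrow> nat \<Rightarrow> real" where
  "radial_projection p x = (\<lambda>j\<in>{..<p}. x j / vec_norm p x)"

text \<open>
  The surface measure of a Borel set \<open>A\<close> of the sphere is \<open>p\<close> times the Lebesgue measure of the
  cone \<open>{r a | 0 < r \<le> 1, a \<in> A}\<close>, by integration in polar coordinates. It is completed to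
  obtain Lebesgue null sets.
\<close>

definition sphere_borel_measure :: "nat \<Rightarrow> (nat \<Rightarrow> real) measure" where
  "sphere_borel_measure p =
     scale_measure (of_nat p)
       (distr (restrict_space (Pi\<^sub>M {..<p} (\<lambda>_. lborel)) (punctured_ball p))
              (restrict_space (Pi\<^sub>M {..<p} (\<lambda>_. borel)) (unit_sphere p))
              (radial_projection p))"

definition sphere_lebesgue :: "nat \<Rightarrow> (nat \<Rightarrow> real) measure" where
  "sphere_lebesgue p = completion (sphere_borel_measure p)"

lemma vec_norm_measurable [measurable]: "vec_norm p \<in> borel_measurable (Pi\<^sub>M {..<p} (\<lambda>_. borel))"
  unfolding vec_norm_def by measurable

lemma radial_projection_in_sphere:
  assumes "x \<in> punctured_ball p"
  shows "radial_projection p x \<in> unit_sphere p"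
proof -
  have *: "(\<Sum>j<p. (x j)\<^sup>2) > 0"
    using assms by (simp add: punctured_ball_def vec_norm_def)
  then have "(\<Sum>j<p. (radial_projection p x j)\<^sup>2) = 1"
    by (simp add: radial_projection_def vec_norm_def power_divide flip: sum_divide_distrib)
  then show ?thesis
    by (simp add: unit_sphere_def vec_norm_def) (simp add: radial_projection_def)
qed

lemma radial_projection_measurable:
  "radial_projection p \<in> restrict_space (Pi\<^sub>M {..<p} (\<lambda>_. lborel)) (punctured_ball p)
     \<rightarrow>\<^sub>M restrict_space (Pi\<^sub>M {..<p} (\<lambda>_. borel)) (unit_sphere p)"
proof (rule measurable_restrict_space2)
  have eq: "sets (Pi\<^sub>M {..<p} (\<lambda>_. lborel :: real measure)) = sets (Pi\<^sub>M {..<p} (\<lambda>_. borel))"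
    by (intro sets_PiM_cong) auto
  show "radial_projection p \<in> space (restrict_space (Pi\<^sub>M {..<p} (\<lambda>_. lborel)) (punctured_ball p))
          \<rightarrow> unit_sphere p"
    using radial_projection_in_sphere by (auto simp: space_restrict_space)
  have "radial_projection p \<in> Pi\<^sub>M {..<p} (\<lambda>_. borel) \<rightarrow>\<^sub>M Pi\<^sub>M {..<p} (\<lambda>_. borel)"
    unfolding radial_projection_def by measurable
  then have "radial_projection p \<in> Pi\<^sub>M {..<p} (\<lambda>_. lborel) \<rightarrow>\<^sub>M Pi\<^sub>M {..<p} (\<lambda>_. borel)"
    by (simp cong: measurable_cong_sets add: measurable_cong_sets[OF eq refl])
  then show "radial_projection p \<in> restrict_space (Pi\<^sub>M {..<p} (\<lambda>_. lborel)) (punctured_ball p)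
          \<rightarrow>\<^sub>M Pi\<^sub>M {..<p} (\<lambda>_. borel)"
    by (rule measurable_restrict_space1)
qed

lemma sphere_borel_measure_eq_cone:
  assumes A: "A \<in> sets (restrict_space (Pi\<^sub>M {..<p} (\<lambda>_. borel)) (unit_sphere p))"
  shows "emeasure (sphere_borel_measure p) A =
           of_nat p * emeasure (Pi\<^sub>M {..<p} (\<lambda>_. lborel))
             {x \<in> punctured_ball p. radial_projection p x \<in> A}"
proof -
  let ?L = "Pi\<^sub>M {..<p} (\<lambda>_. lborel :: real measure)"
  let ?R = "restrict_space ?L (punctured_ball p)"
  have eq: "sets ?L = sets (Pi\<^sub>M {..<p} (\<lambda>_. borel))"
    by (intro sets_PiM_cong) auto
  have sp: "space ?L = {..<p} \<rightarrow>\<^sub>E UNIV"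
    by (simp add: space_PiM)
  have "{x \<in> space (Pi\<^sub>M {..<p} (\<lambda>_. borel)). 0 < vec_norm p x \<and> vec_norm p x \<le> 1}
          \<in> sets (Pi\<^sub>M {..<p} (\<lambda>_. borel))"
    by measurable
  then have ball: "punctured_ball p \<in> sets ?L"
    by (simp add: eq punctured_ball_def space_PiM)
  have sub: "punctured_ball p \<subseteq> space ?L"
    by (auto simp: sp punctured_ball_def)
  have spR: "space ?R = punctured_ball p"
    using sub by (auto simp: space_restrict_space)
  show ?thesis
    unfolding sphere_borel_measure_def emeasure_scale_measure
      emeasure_distr[OF radial_projection_measurable A] spR
    using ball sub
    by (subst emeasure_restrict_space) (auto simp: vimage_def Int_def conj_commute Int_absorb1)
qed

definition dense_in_sphere :: "nat \<Rightarrow> (nat \<Rightarrow> real) set \<Rightarrow> bool" where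
  "dense_in_sphere p A \<longleftrightarrow>
     subtopology (product_topology (\<lambda>_. euclideanreal) {..<p}) (unit_sphere p) closure_of A
       = unit_sphere p"

definition cond_exp_given ::
    "'a measure \<Rightarrow> ('a \<Rightarrow> real) \<Rightarrow> ('a \<Rightarrow> 'b::topological_space) \<Rightarrow> 'a \<Rightarrow> real" where
  "cond_exp_given M Z Y = real_cond_exp M (vimage_algebra (space M) Y borel) Z"

end

theory Submission
  imports Defs
begin

text \<open>
  Saying that \<open>E(Z | Y) = 0\<close> almost surely means that the signed law of \<open>Y\<close> weighted by \<open>Z\<close>
  vanishes: \<open>E(Z 1\<^sub>B(Y)) = 0\<close> for every Borel set \<open>B\<close>
  (\<open>cond_exp_given_eq_0_iff\<close>). In this form it passes from \<open>Y\<close> to every Borel function of \<open>Y\<close>,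
  which gives all implications out of (1), and also (4) \<open>\<Longrightarrow>\<close> (3), since the projection of \<open>X\<close> onto a
  direction in the span of the first \<open>p\<close> basis vectors is a function of the truncation of \<open>X\<close>. As (2)
  contains (3), part (A) reduces to (3) \<open>\<Longrightarrow>\<close> (1).

  Under (3) the Fourier transform \<open>E(Z exp(i \<Sum>\<^sub>j t\<^sub>j x\<^sub>j))\<close> of the weighted law of the coordinates
  \<open>x\<^sub>j\<close> vanishes for all finite families \<open>t\<close>, because
  \<open>\<Sum>\<^sub>j t\<^sub>j x\<^sub>j\<close> is a multiple of a projection onto a unit vector. Multidimensional Fourier uniqueness is
  obtained from Levy's theorem on the line by exchanging one exponential factor after the other for an
  indicator function, the remaining factors being absorbed into a complex weight
  (\<open>integral_prod_indicator_eq_0\<close>). Hence the weighted law of the sequence of coordinates vanishes on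
  cylinders, so it vanishes on the product sigma-algebra; and each Borel set of the Hilbert space is the
  preimage of a set of that sigma-algebra, since a vector is the limit of its truncations
  (\<open>borel_set_determined_by_coordinates\<close>).

  For part (B), exponential integrability makes the power series of the Fourier transform converge, so
  the weighted law of the projection onto \<open>v\<close> vanishes if and only if all directional moments
  \<open>E(Z \<langle>X, v\<rangle>\<^sup>k)\<close> do. If (1) fails, then by part (A) some direction \<open>\<gamma>\<close> on some sphere, and by
  padding with zeros on every sphere of higher dimension, has a nonzero moment, of order \<open>k\<close> say. The
  moment of order \<open>k\<close> is a homogeneous polynomial of the direction, so the exceptional directions lie
  in the zero set of a nonzero polynomial. That set is closed and misses \<open>\<gamma>\<close>, so it is not dense. The
  cone over it meets every line parallel to \<open>\<gamma>\<close> in finitely many points, because the restriction of the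
  polynomial to such a line has the moment of \<open>\<gamma>\<close> as its leading coefficient; by Fubini the cone is a
  null set, and so is its trace on the sphere.
\<close>

section \<open>Conditional expectations that vanish\<close>

lemma cond_exp_given_subalgebra:
  assumes "prob_space M" and Y: "Y \<in> borel_measurable M"
  shows "sigma_finite_subalgebra M (vimage_algebra (space M) Y borel)"
proof -
  interpret prob_space M by fact
  have "subalgebra M (vimage_algebra (space M) Y borel)"
    using sets_image_in_sets[OF refl Y] by (simp add: subalgebra_def)
  then show ?thesis
    using finite_measure_restr_to_subalg[OF _ finite_measure_axioms]
    by (intro sigma_finite_subalgebra.intro) (auto simp: finite_measure_def)
qed

text \<open>
  The sets of the sigma-algebra generated by \<open>Y\<close> are the preimages of Borel sets, so this is the
  defining property of the conditional expectation, compared with that of the constant \<open>0\<close>.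
\<close>
lemma cond_exp_given_eq_0_iff:
  fixes Y :: "'a \<Rightarrow> 'b::topological_space"
  assumes M: "prob_space M" and Y: "Y \<in> borel_measurable M" and Z: "integrable M Z"
  shows "(AE \<omega> in M. cond_exp_given M Z Y \<omega> = 0) \<longleftrightarrow>
    (\<forall>B\<in>sets borel. (\<integral>\<omega>. Z \<omega> * indicator B (Y \<omega>) \<partial>M) = 0)"
proof -
  let ?F = "vimage_algebra (space M) Y borel"
  interpret sigma_finite_subalgebra M ?F
    by (rule cond_exp_given_subalgebra[OF M Y])
  have set_integral: "(\<integral>\<omega>\<in>Y -` B \<inter> space M. Z \<omega> \<partial>M) = (\<integral>\<omega>. Z \<omega> * indicator B (Y \<omega>) \<partial>M)" for B
    unfolding set_lebesgue_integral_def
    by (intro Bochner_Integration.integral_cong) (auto simp: indicator_def)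
  have sets_F: "\<exists>B\<in>sets borel. A = Y -` B \<inter> space M" if "A \<in> sets ?F" for A
    using that by (auto simp: sets_vimage_algebra2)
  show ?thesis
    unfolding cond_exp_given_def
  proof (intro iffI ballI)
    fix B :: "'b set"
    assume zero: "AE \<omega> in M. real_cond_exp M ?F Z \<omega> = 0" and B: "B \<in> sets borel"
    have "(\<integral>\<omega>. Z \<omega> * indicator B (Y \<omega>) \<partial>M)
        = (\<integral>\<omega>\<in>Y -` B \<inter> space M. real_cond_exp M ?F Z \<omega> \<partial>M)"
      unfolding set_integral[symmetric] using Z B by (intro real_cond_exp_intA in_vimage_algebra)
    also have "\<dots> = (\<integral>\<omega>. 0 \<partial>M)"
      unfolding set_lebesgue_integral_def
    proof (rule integral_cong_AE)
      have "Y -` B \<inter> space M \<in> sets M"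
        using Y B by (rule measurable_sets)
      then show "(\<lambda>\<omega>. indicat_real (Y -` B \<inter> space M) \<omega> *\<^sub>R real_cond_exp M ?F Z \<omega>) \<in> borel_measurable M"
        by measurable
    qed (use zero in auto)
    finally show "(\<integral>\<omega>. Z \<omega> * indicator B (Y \<omega>) \<partial>M) = 0"
      by simp
  next
    assume zero: "\<forall>B\<in>sets borel. (\<integral>\<omega>. Z \<omega> * indicator B (Y \<omega>) \<partial>M) = 0"
    show "AE \<omega> in M. real_cond_exp M ?F Z \<omega> = 0"
    proof (rule real_cond_exp_charact)
      fix A assume "A \<in> sets ?F"
      then obtain B where "B \<in> sets borel" "A = Y -` B \<inter> space M"
        using sets_F by blast
      then show "(\<integral>\<omega>\<in>A. Z \<omega> \<partial>M) = (\<integral>\<omega>\<in>A. 0 \<partial>M)"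
        using zero by (simp add: set_integral)
    qed (use Z in auto)
  qed
qed

lemma cond_exp_given_comp_eq_0:
  fixes Y :: "'a \<Rightarrow> 'b::topological_space" and g :: "'b \<Rightarrow> 'c::topological_space"
  assumes M: "prob_space M" and Y: "Y \<in> borel_measurable M" and Z: "integrable M Z"
    and zero: "AE \<omega> in M. cond_exp_given M Z Y \<omega> = 0"
    and g: "g \<in> borel_measurable borel"
  shows "AE \<omega> in M. cond_exp_given M Z (\<lambda>\<omega>. g (Y \<omega>)) \<omega> = 0"
proof -
  have gY: "(\<lambda>\<omega>. g (Y \<omega>)) \<in> borel_measurable M"
    using Y g by (rule measurable_compose)
  have "(\<integral>\<omega>. Z \<omega> * indicator B (g (Y \<omega>)) \<partial>M) = 0" if "B \<in> sets borel" for B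
  proof -
    have "g -` B \<in> sets borel"
      using measurable_sets[OF g that] by simp
    then have "(\<integral>\<omega>. Z \<omega> * indicator (g -` B) (Y \<omega>) \<partial>M) = 0"
      using zero cond_exp_given_eq_0_iff[OF M Y Z] by blast
    then show ?thesis
      by (simp add: indicator_def)
  qed
  then show ?thesis
    using cond_exp_given_eq_0_iff[OF M gY Z] by blast
qed

text \<open>
  The passage from indicators to an unbounded \<open>g\<close>: polynomials of \<open>Y\<close> are needed for the moments,
  sine and cosine for the Fourier transform.
\<close>
lemma cond_exp_given_eq_0_integral:
  fixes Y :: "'a \<Rightarrow> 'b::topological_space" and g :: "'b \<Rightarrow> real"
  assumes M: "prob_space M" and Y: "Y \<in> borel_measurable M" and Z: "integrable M Z"
    and zero: "AE \<omega> in M. cond_exp_given M Z Y \<omega> = 0"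
    and g: "g \<in> borel_measurable borel" and gZ: "integrable M (\<lambda>\<omega>. g (Y \<omega>) * Z \<omega>)"
  shows "(\<integral>\<omega>. g (Y \<omega>) * Z \<omega> \<partial>M) = 0"
proof -
  let ?F = "vimage_algebra (space M) Y borel"
  interpret sigma_finite_subalgebra M ?F
    by (rule cond_exp_given_subalgebra[OF M Y])
  have gY: "(\<lambda>\<omega>. g (Y \<omega>)) \<in> borel_measurable ?F"
    by (rule measurable_compose[OF measurable_vimage_algebra1 g]) simp
  have [measurable]: "(\<lambda>\<omega>. g (Y \<omega>)) \<in> borel_measurable M"
    using Y g by (rule measurable_compose)
  have "(\<integral>\<omega>. g (Y \<omega>) * Z \<omega> \<partial>M) = (\<integral>\<omega>. g (Y \<omega>) * real_cond_exp M ?F Z \<omega> \<partial>M)"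
    using real_cond_exp_intg(2)[OF gZ gY] Z by simp
  also have "\<dots> = (\<integral>\<omega>. 0 \<partial>M)"
    by (rule integral_cong_AE) (use zero in \<open>auto simp: cond_exp_given_def\<close>)
  finally show ?thesis
    by simp
qed

lemma integral_iexp_eq_0_if_cond_exp_given_eq_0:
  fixes Y :: "'a \<Rightarrow> real"
  assumes M: "prob_space M" and Y[measurable]: "Y \<in> borel_measurable M" and Z: "integrable M Z"
    and zero: "AE \<omega> in M. cond_exp_given M Z Y \<omega> = 0"
  shows "(\<integral>\<omega>. complex_of_real (Z \<omega>) * iexp (t * Y \<omega>) \<partial>M) = 0"
proof -
  note [measurable] = borel_measurable_integrable[OF Z]
  have int: "integrable M (\<lambda>\<omega>. complex_of_real (Z \<omega>) * iexp (t * Y \<omega>))"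
    by (rule Bochner_Integration.integrable_bound[OF Z]) (auto simp: norm_mult)
  have cos: "integrable M (\<lambda>\<omega>. cos (t * Y \<omega>) * Z \<omega>)"
    and sin: "integrable M (\<lambda>\<omega>. sin (t * Y \<omega>) * Z \<omega>)"
    by (rule Bochner_Integration.integrable_bound[OF Z];
        auto simp: abs_mult intro!: mult_left_le_one_le)+
  have "Re (\<integral>\<omega>. complex_of_real (Z \<omega>) * iexp (t * Y \<omega>) \<partial>M) = (\<integral>\<omega>. cos (t * Y \<omega>) * Z \<omega> \<partial>M)"
    by (subst integral_Re[OF int, symmetric]) (simp add: Re_exp mult.commute)
  moreover have "\<dots> = 0"
    by (rule cond_exp_given_eq_0_integral[OF M Y Z zero _ cos]) simp
  moreover have "Im (\<integral>\<omega>. complex_of_real (Z \<omega>) * iexp (t * Y \<omega>) \<partial>M) = (\<integral>\<omega>. sin (t * Y \<omega>) * Z \<omega> \<partial>M)"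
    by (subst integral_Im[OF int, symmetric]) (simp add: Im_exp mult.commute)
  moreover have "\<dots> = 0"
    by (rule cond_exp_given_eq_0_integral[OF M Y Z zero _ sin]) simp
  ultimately show ?thesis
    by (simp add: complex_eq_iff)
qed

section \<open>Fourier uniqueness for weighted laws\<close>

text \<open>
  Levy's uniqueness theorem is about probability measures. It applies to the signed law of \<open>Y\<close>
  weighted by \<open>Z\<close> after splitting \<open>Z\<close> into positive and negative part: both have the same mass
  \<open>m\<close>, as the transform vanishes at \<open>0\<close>, and can be normalised by it unless \<open>Z = 0\<close> almost
  everywhere.
\<close>
lemma integral_indicator_eq_0_real:
  fixes Y Z :: "'a \<Rightarrow> real"
  assumes Y[measurable]: "Y \<in> borel_measurable M" and Z: "integrable M Z"
    and iexp: "\<And>t. (\<integral>\<omega>. complex_of_real (Z \<omega>) * iexp (t * Y \<omega>) \<partial>M) = 0"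
    and B[measurable]: "B \<in> sets borel"
  shows "(\<integral>\<omega>. Z \<omega> * indicator B (Y \<omega>) \<partial>M) = 0"
proof -
  note [measurable] = borel_measurable_integrable[OF Z]
  define pos where "pos \<omega> = max 0 (Z \<omega>)" for \<omega>
  define neg where "neg \<omega> = max 0 (- Z \<omega>)" for \<omega>
  define m where "m = (\<integral>\<omega>. pos \<omega> \<partial>M)"
  have Z_eq: "Z \<omega> = pos \<omega> - neg \<omega>" and pos_ge: "0 \<le> pos \<omega>" and neg_ge: "0 \<le> neg \<omega>" for \<omega>
    by (auto simp: pos_def neg_def)
  have int_pos: "integrable M pos" and int_neg: "integrable M neg"
    unfolding pos_def neg_def using Z by auto
  note [measurable] = borel_measurable_integrable[OF int_pos] borel_measurable_integrable[OF int_neg]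
  have "(\<integral>\<omega>. Z \<omega> \<partial>M) = 0"
    using iexp[of 0] by simp
  then have m_neg: "m = (\<integral>\<omega>. neg \<omega> \<partial>M)"
    using int_pos int_neg by (simp add: Z_eq m_def)
  have ind: "integrable M (\<lambda>\<omega>. f \<omega> * indicator B (Y \<omega>))" if "integrable M f" for f :: "'a \<Rightarrow> real"
    by (rule Bochner_Integration.integrable_bound[OF that])
      (use borel_measurable_integrable[OF that] in \<open>auto simp: indicator_def\<close>)
  have "(\<integral>\<omega>. pos \<omega> * indicator B (Y \<omega>) \<partial>M) = (\<integral>\<omega>. neg \<omega> * indicator B (Y \<omega>) \<partial>M)"
  proof (cases "m = 0")
    case True
    have "AE \<omega> in M. pos \<omega> = 0" "AE \<omega> in M. neg \<omega> = 0"
      using True m_neg integral_nonneg_eq_0_iff_AE[OF int_pos] integral_nonneg_eq_0_iff_AE[OF int_neg]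
      by (simp_all add: pos_ge neg_ge m_def)
    then show ?thesis
      by (intro integral_cong_AE) auto
  next
    case False
    have m_pos: "m > 0"
      using False Bochner_Integration.integral_nonneg[of M pos] by (simp add: m_def pos_ge order_less_le)
    define law where "law f = distr (density M (\<lambda>\<omega>. ennreal (f \<omega> / m))) borel Y" for f
    have law: "real_distribution (law f)"
      "char (law f) t = (\<integral>\<omega>. complex_of_real (f \<omega>) * iexp (t * Y \<omega>) \<partial>M) / m"
      "measure (law f) B = (\<integral>\<omega>. f \<omega> * indicator B (Y \<omega>) \<partial>M) / m"
      if f: "integrable M f" "\<And>\<omega>. 0 \<le> f \<omega>" "(\<integral>\<omega>. f \<omega> \<partial>M) = m" for f :: "'a \<Rightarrow> real" and t
    proof -
      note [measurable] = borel_measurable_integrable[OF f(1)]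
      have "(\<integral>\<^sup>+ \<omega>. ennreal (f \<omega> / m) \<partial>M) = ennreal (\<integral>\<omega>. f \<omega> / m \<partial>M)"
        using f m_pos by (intro nn_integral_eq_integral) auto
      also have "\<dots> = 1"
        using f(3) m_pos by simp
      finally interpret D: prob_space "density M (\<lambda>\<omega>. ennreal (f \<omega> / m))"
        by (intro prob_spaceI) (simp add: emeasure_density cong: nn_integral_cong_simp)
      show "real_distribution (law f)"
        unfolding law_def by (rule D.real_distribution_distr) simp
      have "char (law f) t = (\<integral>\<omega>. (f \<omega> / m) *\<^sub>R iexp (t * Y \<omega>) \<partial>M)"
        unfolding law_def char_def using f(2) m_pos
        by (simp add: integral_distr integral_density)
      also have "\<dots> = (\<integral>\<omega>. (complex_of_real (f \<omega>) * iexp (t * Y \<omega>)) / m \<partial>M)"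
        by (simp add: scaleR_conv_of_real)
      finally show "char (law f) t = (\<integral>\<omega>. complex_of_real (f \<omega>) * iexp (t * Y \<omega>) \<partial>M) / m"
        by simp
      have "measure (law f) B = (\<integral>y. indicator B y \<partial>law f)"
        by (simp add: law_def)
      also have "\<dots> = (\<integral>\<omega>. (f \<omega> * indicator B (Y \<omega>)) / m \<partial>M)"
        unfolding law_def using f(2) m_pos
        by (subst integral_distr, simp, simp, subst integral_density) auto
      finally show "measure (law f) B = (\<integral>\<omega>. f \<omega> * indicator B (Y \<omega>) \<partial>M) / m"
        by simp
    qed
    note law_pos = law[OF int_pos pos_ge m_def[symmetric]]
    note law_neg = law[OF int_neg neg_ge m_neg[symmetric]]
    have ci: "integrable M (\<lambda>\<omega>. complex_of_real (f \<omega>) * iexp (t * Y \<omega>))"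
      if "integrable M f" for f t
      by (rule Bochner_Integration.integrable_bound[OF that])
        (use borel_measurable_integrable[OF that] in \<open>auto simp: norm_mult\<close>)
    have "char (law pos) = char (law neg)"
    proof
      fix t
      have "(\<integral>\<omega>. complex_of_real (pos \<omega>) * iexp (t * Y \<omega>) \<partial>M)
          - (\<integral>\<omega>. complex_of_real (neg \<omega>) * iexp (t * Y \<omega>) \<partial>M)
          = (\<integral>\<omega>. complex_of_real (Z \<omega>) * iexp (t * Y \<omega>) \<partial>M)"
        by (subst Bochner_Integration.integral_diff[OF ci[OF int_pos] ci[OF int_neg], symmetric])
          (simp add: Z_eq algebra_simps)
      then show "char (law pos) t = char (law neg) t"
        using iexp[of t] by (simp add: law_pos(2) law_neg(2))
    qed
    then have "law pos = law neg"
      by (rule Levy_uniqueness[OF law_pos(1) law_neg(1)])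
    then show ?thesis
      using law_pos(3) law_neg(3) m_pos by simp
  qed
  moreover have "(\<integral>\<omega>. Z \<omega> * indicator B (Y \<omega>) \<partial>M)
      = (\<integral>\<omega>. pos \<omega> * indicator B (Y \<omega>) \<partial>M) - (\<integral>\<omega>. neg \<omega> * indicator B (Y \<omega>) \<partial>M)"
    by (subst Bochner_Integration.integral_diff[symmetric])
      (auto intro!: ind int_pos int_neg simp: Z_eq algebra_simps)
  ultimately show ?thesis
    by simp
qed

text \<open>
  Since \<open>t\<close> ranges over all reals, conjugation shows that the transform weighted by the conjugate of
  \<open>W\<close> vanishes as well, and with it the transforms weighted by the real and imaginary parts of \<open>W\<close>.
\<close>
lemma integral_indicator_eq_0_complex:
  fixes Y :: "'a \<Rightarrow> real" and W :: "'a \<Rightarrow> complex"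
  assumes Y[measurable]: "Y \<in> borel_measurable M" and W: "integrable M W"
    and iexp: "\<And>t. (\<integral>\<omega>. W \<omega> * iexp (t * Y \<omega>) \<partial>M) = 0"
    and B[measurable]: "B \<in> sets borel"
  shows "(\<integral>\<omega>. W \<omega> * indicator B (Y \<omega>) \<partial>M) = 0"
proof -
  note [measurable] = borel_measurable_integrable[OF W]
  have ci: "integrable M (\<lambda>\<omega>. V \<omega> * iexp (t * Y \<omega>))" if "integrable M V" for V t
    by (rule Bochner_Integration.integrable_bound[OF that])
      (use borel_measurable_integrable[OF that] in \<open>auto simp: norm_mult\<close>)
  have W_cnj: "integrable M (\<lambda>\<omega>. cnj (W \<omega>))"
    using W by simp
  have cnj_iexp: "(\<integral>\<omega>. cnj (W \<omega>) * iexp (t * Y \<omega>) \<partial>M) = 0" for t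
  proof -
    have "(\<integral>\<omega>. cnj (W \<omega>) * iexp (t * Y \<omega>) \<partial>M) = cnj (\<integral>\<omega>. W \<omega> * iexp (- t * Y \<omega>) \<partial>M)"
      by (simp add: exp_cnj flip: Bochner_Integration.integral_cnj)
    then show ?thesis
      using iexp[of "- t"] by simp
  qed
  have Re: "(\<integral>\<omega>. complex_of_real (Re (W \<omega>)) * iexp (t * Y \<omega>) \<partial>M) = 0" for t
  proof -
    have "(\<integral>\<omega>. complex_of_real (Re (W \<omega>)) * iexp (t * Y \<omega>) \<partial>M)
        = (\<integral>\<omega>. (W \<omega> * iexp (t * Y \<omega>) + cnj (W \<omega>) * iexp (t * Y \<omega>)) / 2 \<partial>M)"
      by (intro Bochner_Integration.integral_cong refl)
        (simp add: complex_add_cnj flip: distrib_right)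
    also have "\<dots> = 0"
      unfolding integral_divide_zero Bochner_Integration.integral_add[OF ci[OF W] ci[OF W_cnj]] iexp cnj_iexp
      by simp
    finally show ?thesis .
  qed
  have Im: "(\<integral>\<omega>. complex_of_real (Im (W \<omega>)) * iexp (t * Y \<omega>) \<partial>M) = 0" for t
  proof -
    have "(\<integral>\<omega>. complex_of_real (Im (W \<omega>)) * iexp (t * Y \<omega>) \<partial>M)
        = (\<integral>\<omega>. (W \<omega> * iexp (t * Y \<omega>) - cnj (W \<omega>) * iexp (t * Y \<omega>)) / (2 * \<i>) \<partial>M)"
      by (intro Bochner_Integration.integral_cong refl)
        (simp add: complex_diff_cnj flip: left_diff_distrib, simp add: mult_ac)
    also have "\<dots> = 0"
      unfolding integral_divide_zero Bochner_Integration.integral_diff[OF ci[OF W] ci[OF W_cnj]] iexp cnj_iexp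
      by simp
    finally show ?thesis .
  qed
  have ind: "integrable M (\<lambda>\<omega>. W \<omega> * indicator B (Y \<omega>))"
    by (rule Bochner_Integration.integrable_bound[OF W]) (auto simp: indicator_def)
  have "Re (\<integral>\<omega>. W \<omega> * indicator B (Y \<omega>) \<partial>M) = (\<integral>\<omega>. Re (W \<omega>) * indicator B (Y \<omega>) \<partial>M)"
    by (subst integral_Re[OF ind, symmetric])
      (auto simp: indicator_def intro!: Bochner_Integration.integral_cong)
  moreover have "\<dots> = 0"
    using W by (intro integral_indicator_eq_0_real Re) auto
  moreover have "Im (\<integral>\<omega>. W \<omega> * indicator B (Y \<omega>) \<partial>M) = (\<integral>\<omega>. Im (W \<omega>) * indicator B (Y \<omega>) \<partial>M)"
    by (subst integral_Im[OF ind, symmetric])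
      (auto simp: indicator_def intro!: Bochner_Integration.integral_cong)
  moreover have "\<dots> = 0"
    using W by (intro integral_indicator_eq_0_real Im) auto
  ultimately show ?thesis
    by (simp add: complex_eq_iff)
qed

text \<open>
  The weight \<open>W\<close> is general in order to carry the induction: with all other frequencies fixed, the
  remaining exponential factors form part of the weight while the factor of one variable is exchanged
  for an indicator; afterwards this indicator joins the weight.
\<close>
lemma integral_prod_indicator_eq_0:
  fixes Y :: "'i \<Rightarrow> 'a \<Rightarrow> real" and W :: "'a \<Rightarrow> complex"
  assumes "finite J" and Y[measurable]: "\<And>j. j \<in> J \<Longrightarrow> Y j \<in> borel_measurable M" and "integrable M W"
    and "\<And>t. (\<integral>\<omega>. W \<omega> * iexp (\<Sum>j\<in>J. t j * Y j \<omega>) \<partial>M) = 0"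
    and "\<And>j. j \<in> J \<Longrightarrow> B j \<in> sets borel"
  shows "(\<integral>\<omega>. W \<omega> * (\<Prod>j\<in>J. indicator (B j) (Y j \<omega>)) \<partial>M) = 0"
  using assms
proof (induction J arbitrary: W rule: finite_induct)
  case empty
  then show ?case
    by simp
next
  case (insert a J)
  note [measurable] = insert.prems(1) borel_measurable_integrable[OF insert.prems(2)]
  have [measurable]: "B a \<in> sets borel" "Y a \<in> borel_measurable M"
    using insert.prems by auto
  have Ym[measurable]: "Y j \<in> borel_measurable M" if "j \<in> J" for j
    using insert.prems that by auto
  let ?W = "\<lambda>\<omega>. W \<omega> * indicator (B a) (Y a \<omega>)"
  have "(\<integral>\<omega>. ?W \<omega> * (\<Prod>j\<in>J. indicator (B j) (Y j \<omega>)) \<partial>M) = 0"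
  proof (rule insert.IH)
    show "integrable M ?W"
      by (rule Bochner_Integration.integrable_bound[OF insert.prems(2)]) (auto simp: indicator_def)
    fix t :: "'i \<Rightarrow> real"
    let ?V = "\<lambda>\<omega>. W \<omega> * iexp (\<Sum>j\<in>J. t j * Y j \<omega>)"
    have "(\<integral>\<omega>. ?V \<omega> * indicator (B a) (Y a \<omega>) \<partial>M) = 0"
    proof (rule integral_indicator_eq_0_complex)
      show "integrable M ?V"
        by (rule Bochner_Integration.integrable_bound[OF insert.prems(2)]) (auto simp: norm_mult)
      fix u
      have "(\<Sum>j\<in>insert a J. (t(a := u)) j * Y j \<omega>) = u * Y a \<omega> + (\<Sum>j\<in>J. t j * Y j \<omega>)" for \<omega>
        using insert.hyps by (auto intro!: sum.cong)
      then show "(\<integral>\<omega>. ?V \<omega> * iexp (u * Y a \<omega>) \<partial>M) = 0"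
        using insert.prems(3)[of "t(a := u)"]
        by (simp add: exp_add distrib_left mult_ac)
    qed auto
    then show "(\<integral>\<omega>. ?W \<omega> * iexp (\<Sum>j\<in>J. t j * Y j \<omega>) \<partial>M) = 0"
      by (simp add: mult_ac)
  qed (use insert.prems in auto)
  then show ?case
    using insert.hyps by (simp add: mult_ac)
qed

text \<open>
  The laws of the sequence \<open>Y\<close> weighted by the positive and the negative part of \<open>Z\<close> are finite
  measures that agree on cylinders, which form a generator closed under intersections.
\<close>
lemma integral_indicator_PiM_eq_0:
  fixes Y :: "'i \<Rightarrow> 'a \<Rightarrow> real" and Z :: "'a \<Rightarrow> real"
  assumes Y[measurable]: "\<And>j. Y j \<in> borel_measurable M" and Z: "integrable M Z"
    and cylinder: "\<And>J B. finite J \<Longrightarrow> (\<And>j. j \<in> J \<Longrightarrow> B j \<in> sets borel) \<Longrightarrow>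
      (\<integral>\<omega>. Z \<omega> * (\<Prod>j\<in>J. indicator (B j) (Y j \<omega>)) \<partial>M) = 0"
    and C: "C \<in> sets (Pi\<^sub>M UNIV (\<lambda>_. borel))"
  shows "(\<integral>\<omega>. Z \<omega> * indicator C (\<lambda>j. Y j \<omega>) \<partial>M) = 0"
proof -
  let ?P = "Pi\<^sub>M UNIV (\<lambda>_::'i. borel :: real measure)"
  define pos where "pos \<omega> = max 0 (Z \<omega>)" for \<omega>
  define neg where "neg \<omega> = max 0 (- Z \<omega>)" for \<omega>
  have Z_eq: "Z \<omega> = pos \<omega> - neg \<omega>" and pos_ge: "0 \<le> pos \<omega>" and neg_ge: "0 \<le> neg \<omega>" for \<omega>
    by (auto simp: pos_def neg_def)
  have int_pos: "integrable M pos" and int_neg: "integrable M neg"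
    unfolding pos_def neg_def using Z by auto
  have Ym: "(\<lambda>\<omega> j. Y j \<omega>) \<in> M \<rightarrow>\<^sub>M ?P"
    by (rule measurable_PiM_single') auto
  have ind: "integrable M (\<lambda>\<omega>. f \<omega> * indicator A (\<lambda>j. Y j \<omega>))"
    if "integrable M f" "A \<in> sets ?P" for f :: "'a \<Rightarrow> real" and A
  proof (rule Bochner_Integration.integrable_bound[OF that(1)])
    note [measurable] = borel_measurable_integrable[OF that(1)]
    have "(\<lambda>\<omega>. indicat_real A (\<lambda>j. Y j \<omega>)) \<in> borel_measurable M"
      by (rule measurable_compose[OF Ym]) (use that(2) in simp)
    then show "(\<lambda>\<omega>. f \<omega> * indicator A (\<lambda>j. Y j \<omega>)) \<in> borel_measurable M"
      by measurable
  qed (auto simp: indicator_def)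
  define law where "law f = distr (density M (\<lambda>\<omega>. ennreal (f \<omega>))) ?P (\<lambda>\<omega> j. Y j \<omega>)" for f
  have law: "emeasure (law f) A = ennreal (\<integral>\<omega>. f \<omega> * indicator A (\<lambda>j. Y j \<omega>) \<partial>M)"
    if f: "integrable M f" "\<And>\<omega>. 0 \<le> f \<omega>" and A: "A \<in> sets ?P" for f :: "'a \<Rightarrow> real" and A
  proof -
    have "emeasure (law f) A
        = emeasure (density M (\<lambda>\<omega>. ennreal (f \<omega>))) ((\<lambda>\<omega> j. Y j \<omega>) -` A \<inter> space M)"
      unfolding law_def using Ym A by (subst emeasure_distr) auto
    also have "\<dots> = (\<integral>\<^sup>+ \<omega>. ennreal (f \<omega>) * indicator ((\<lambda>\<omega> j. Y j \<omega>) -` A \<inter> space M) \<omega> \<partial>M)"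
      using borel_measurable_integrable[OF f(1)] measurable_sets[OF Ym A]
      by (subst emeasure_density) auto
    also have "\<dots> = (\<integral>\<^sup>+ \<omega>. ennreal (f \<omega> * indicator A (\<lambda>j. Y j \<omega>)) \<partial>M)"
      by (intro nn_integral_cong) (auto simp: indicator_def)
    also have "\<dots> = ennreal (\<integral>\<omega>. f \<omega> * indicator A (\<lambda>j. Y j \<omega>) \<partial>M)"
      using ind[OF f(1) A] f(2) by (intro nn_integral_eq_integral) auto
    finally show ?thesis .
  qed
  have split: "(\<integral>\<omega>. Z \<omega> * indicator A (\<lambda>j. Y j \<omega>) \<partial>M)
      = (\<integral>\<omega>. pos \<omega> * indicator A (\<lambda>j. Y j \<omega>) \<partial>M) - (\<integral>\<omega>. neg \<omega> * indicator A (\<lambda>j. Y j \<omega>) \<partial>M)"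
    if "A \<in> sets ?P" for A
    by (subst Bochner_Integration.integral_diff[OF ind[OF int_pos that] ind[OF int_neg that], symmetric])
      (simp add: Z_eq algebra_simps)
  have "law pos = law neg"
  proof (rule measure_eqI_PiM_infinite)
    show "sets (law pos) = sets ?P" "sets (law neg) = sets ?P"
      by (simp_all add: law_def)
    have "space (law pos) \<in> sets ?P"
      using sets.top[of ?P] by (simp add: law_def)
    then show "finite_measure (law pos)"
      by (intro finite_measureI) (simp add: law[OF int_pos pos_ge])
  next
    fix B and J :: "'i set"
    assume J: "finite J" and B: "\<And>j. j \<in> J \<Longrightarrow> B j \<in> sets (borel :: real measure)"
    let ?A = "prod_emb UNIV (\<lambda>_. borel :: real measure) J (Pi\<^sub>E J B)"
    have A: "?A \<in> sets ?P"
      using J B by (intro sets_PiM_I) auto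
    have "indicator ?A (\<lambda>j. Y j \<omega>) = (\<Prod>j\<in>J. indicat_real (B j) (Y j \<omega>))" for \<omega>
      using J by (auto simp: prod_emb_def PiE_iff indicator_def prod_zero_iff intro!: prod.neutral)
    then have "(\<integral>\<omega>. Z \<omega> * indicator ?A (\<lambda>j. Y j \<omega>) \<partial>M) = 0"
      using cylinder[OF J B] by simp
    then show "emeasure (law pos) ?A = emeasure (law neg) ?A"
      using split[OF A] by (simp add: law[OF int_pos pos_ge A] law[OF int_neg neg_ge A])
  qed
  then have "ennreal (\<integral>\<omega>. pos \<omega> * indicator C (\<lambda>j. Y j \<omega>) \<partial>M)
      = ennreal (\<integral>\<omega>. neg \<omega> * indicator C (\<lambda>j. Y j \<omega>) \<partial>M)"
    using law[OF int_pos pos_ge C] law[OF int_neg neg_ge C] by simp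
  then show ?thesis
    using split[OF C] by (simp add: pos_ge neg_ge)
qed

section \<open>Coordinates with respect to an orthonormal basis\<close>

lemma measurable_inner_right:
  fixes X :: "'a \<Rightarrow> 'h::real_inner"
  assumes "X \<in> borel_measurable M"
  shows "(\<lambda>\<omega>. inner (X \<omega>) v) \<in> borel_measurable M"
  by (rule measurable_compose[OF assms]) (intro borel_measurable_continuous_onI continuous_intros)

lemma orthonormal_basis_inner:
  "orthonormal_basis \<rho> \<Longrightarrow> inner (\<rho> i) (\<rho> j) = (if i = j then 1 else 0)"
  by (simp add: orthonormal_basis_def)

lemma inner_truncation:
  assumes "orthonormal_basis \<rho>" "j < p"
  shows "inner (truncation \<rho> p x) (\<rho> j) = inner x (\<rho> j)"
  using assms by (simp add: truncation_def inner_sum_left orthonormal_basis_inner if_distrib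
      cong: if_cong)

text \<open>
  The truncation is an orthogonal projection, so its residual is an orthogonal component of the vector.
\<close>
lemma norm_diff_truncation_le:
  assumes "orthonormal_basis \<rho>"
  shows "norm (x - truncation \<rho> p x) \<le> norm x"
proof -
  let ?t = "truncation \<rho> p x"
  have "inner (x - ?t) ?t = (\<Sum>j<p. inner x (\<rho> j) * inner (x - ?t) (\<rho> j))"
    by (subst (2) truncation_def) (simp add: inner_sum_right)
  also have "\<dots> = 0"
    using assms by (intro sum.neutral) (auto simp: inner_diff_left inner_truncation)
  finally have "orthogonal (x - ?t) ?t"
    by (simp add: orthogonal_def)
  then have "(norm x)\<^sup>2 = (norm (x - ?t))\<^sup>2 + (norm ?t)\<^sup>2"
    using norm_add_Pythagorean[of "x - ?t" ?t] by simp
  then have "(norm (x - ?t))\<^sup>2 \<le> (norm x)\<^sup>2"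
    by simp
  then show ?thesis
    by (rule power2_le_imp_le) simp
qed

text \<open>
  Approximate \<open>x\<close> by a finite combination \<open>y\<close> of basis vectors. Long truncations fix \<open>y\<close>, so the
  residual of \<open>x\<close> is that of \<open>x - y\<close>, whose norm is at most that of \<open>x - y\<close>.
\<close>
lemma truncation_tendsto:
  assumes \<rho>: "orthonormal_basis \<rho>"
  shows "(\<lambda>p. truncation \<rho> p x) \<longlonglongrightarrow> x"
proof (rule metric_LIMSEQ_I)
  fix e :: real
  assume "e > 0"
  moreover have "x \<in> closure (span (range \<rho>))"
    using \<rho> by (simp add: orthonormal_basis_def)
  ultimately obtain y where y: "y \<in> span (range \<rho>)" "dist y x < e"
    by (auto simp: closure_approachable)
  have diff: "truncation \<rho> p (a - b) = truncation \<rho> p a - truncation \<rho> p b" for p a b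
    by (simp add: truncation_def inner_diff_left scaleR_diff_left sum_subtractf)
  have "\<exists>N. \<forall>p\<ge>N. truncation \<rho> p y = y"
    using y(1)
  proof (induction rule: span_induct_alt)
    case base
    then show ?case
      by (simp add: truncation_def)
  next
    case (step c z y)
    then obtain k N where k: "z = \<rho> k" and N: "\<And>p. p \<ge> N \<Longrightarrow> truncation \<rho> p y = y"
      by auto
    have "truncation \<rho> p (c *\<^sub>R z + y) = c *\<^sub>R z + y" if "p \<ge> max N (Suc k)" for p
    proof -
      have "truncation \<rho> p (c *\<^sub>R z + y) = c *\<^sub>R truncation \<rho> p z + truncation \<rho> p y"
        by (simp add: truncation_def inner_add_left scaleR_add_left sum.distrib scaleR_sum_right)
      moreover have "truncation \<rho> p z = (\<Sum>j<p. if k = j then \<rho> j else 0)"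
        unfolding truncation_def k using \<rho>
        by (intro sum.cong) (auto simp: orthonormal_basis_inner)
      moreover have "\<dots> = z"
        using that by (simp add: k)
      ultimately show ?thesis
        using N that by simp
    qed
    then show ?case
      by blast
  qed
  then obtain N where N: "\<And>p. p \<ge> N \<Longrightarrow> truncation \<rho> p y = y"
    by blast
  have "dist (truncation \<rho> p x) x < e" if "p \<ge> N" for p
  proof -
    have "dist (truncation \<rho> p x) x = norm ((x - y) - truncation \<rho> p (x - y))"
      using N[OF that] by (simp add: diff dist_norm norm_minus_commute)
    also have "\<dots> \<le> norm (x - y)"
      by (rule norm_diff_truncation_le[OF \<rho>])
    also have "\<dots> < e"
      using y(2) by (simp add: dist_norm norm_minus_commute)
    finally show ?thesis .
  qed
  then show "\<exists>N. \<forall>p\<ge>N. dist (truncation \<rho> p x) x < e"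
    by blast
qed

text \<open>
  Equivalently, the identity is measurable from the sigma-algebra generated by the coordinates to the
  Borel sets. It is the pointwise limit of the truncations, and each truncation is a continuous function
  of the coordinate sequence.
\<close>
lemma borel_set_determined_by_coordinates:
  fixes \<rho> :: "nat \<Rightarrow> 'h::real_inner"
  assumes \<rho>: "orthonormal_basis \<rho>" and B: "B \<in> sets borel"
  obtains C where "C \<in> sets (Pi\<^sub>M UNIV (\<lambda>_. borel))" "B = {x. (\<lambda>j. inner x (\<rho> j)) \<in> C}"
proof -
  let ?P = "Pi\<^sub>M UNIV (\<lambda>_::nat. borel :: real measure)"
  let ?c = "\<lambda>x j. inner x (\<rho> j)"
  let ?F = "vimage_algebra UNIV ?c ?P"
  have c: "?c \<in> ?F \<rightarrow>\<^sub>M ?P"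
    by (rule measurable_vimage_algebra1) (simp add: space_PiM)
  have "(\<lambda>x. x) \<in> borel_measurable ?F"
  proof (rule borel_measurable_LIMSEQ_metric)
    fix p
    have "continuous_on UNIV (\<lambda>a::nat \<Rightarrow> real. \<Sum>j<p. a j *\<^sub>R \<rho> j)"
      by (intro continuous_on_sum continuous_on_scaleR continuous_on_const
          continuous_on_product_coordinates)
    then have "(\<lambda>a. \<Sum>j<p. a j *\<^sub>R \<rho> j) \<in> borel_measurable ?P"
      using borel_measurable_continuous_onI measurable_cong_sets[OF sets_PiM_equal_borel refl]
      by blast
    with c show "(\<lambda>x. truncation \<rho> p x) \<in> borel_measurable ?F"
      unfolding truncation_def by (rule measurable_compose)
  qed (rule truncation_tendsto[OF \<rho>])
  then have "B \<in> sets ?F"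
    using B measurable_sets[of "\<lambda>x. x" ?F borel B] by simp
  then obtain C where "C \<in> sets ?P" "B = ?c -` C"
    by (auto simp: sets_vimage_algebra2 space_PiM)
  then show thesis
    using that by (simp add: vimage_def)
qed

lemma inner_from_coords: "inner x (from_coords \<rho> p \<gamma>) = (\<Sum>j<p. \<gamma> j * inner x (\<rho> j))"
  by (simp add: from_coords_def inner_sum_right)

lemma norm_from_coords:
  assumes "orthonormal_basis \<rho>"
  shows "norm (from_coords \<rho> p \<gamma>) = vec_norm p \<gamma>"
proof -
  have "inner (from_coords \<rho> p \<gamma>) (\<rho> j) = \<gamma> j" if "j < p" for j
    using that assms
    by (simp add: from_coords_def inner_sum_left orthonormal_basis_inner if_distrib cong: if_cong)
  then show ?thesis
    by (simp add: norm_eq_sqrt_inner inner_from_coords vec_norm_def power2_eq_square)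
qed

section \<open>Vanishing in all finite-dimensional directions\<close>

text \<open>
  A combination of coordinates with coefficients \<open>t\<close> is the Euclidean norm of \<open>t\<close> times the
  projection of \<open>X\<close> onto a unit vector; for \<open>t = 0\<close>, the mean of \<open>Z\<close> is used instead.
\<close>
lemma integral_iexp_coordinates_eq_0:
  fixes X :: "'a \<Rightarrow> 'h::real_inner" and Z :: "'a \<Rightarrow> real"
  assumes M: "prob_space M" and X: "X \<in> borel_measurable M" and Z: "integrable M Z"
    and mean: "(\<integral>\<omega>. Z \<omega> \<partial>M) = 0"
    and zero: "\<And>p \<gamma>. 1 \<le> p \<Longrightarrow> \<gamma> \<in> unit_sphere p \<Longrightarrow>
      AE \<omega> in M. cond_exp_given M Z (\<lambda>\<omega>. inner (X \<omega>) (from_coords \<rho> p \<gamma>)) \<omega> = 0"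
    and J: "finite J"
  shows "(\<integral>\<omega>. complex_of_real (Z \<omega>) * iexp (\<Sum>j\<in>J. t j * inner (X \<omega>) (\<rho> j)) \<partial>M) = 0"
proof -
  define s where "s = sqrt (\<Sum>j\<in>J. (t j)\<^sup>2)"
  show ?thesis
  proof (cases "s = 0")
    case True
    then have "(\<Sum>j\<in>J. (t j)\<^sup>2) = 0"
      by (simp add: s_def)
    then have "\<forall>j\<in>J. t j = 0"
      using J by (simp add: sum_nonneg_eq_0_iff)
    then show ?thesis
      using mean by simp
  next
    case False
    obtain p0 where "J \<subseteq> {..<p0}"
      using J by (auto simp: finite_nat_set_iff_bounded)
    then have p: "J \<subseteq> {..<Suc p0}"
      by auto
    define \<gamma> where "\<gamma> = (\<lambda>j\<in>{..<Suc p0}. if j \<in> J then t j / s else 0)"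
    have restrict: "(\<Sum>j<Suc p0. f j (\<gamma> j)) = (\<Sum>j\<in>J. f j (t j / s))" if "\<And>j. f j 0 = 0"
      for f :: "nat \<Rightarrow> real \<Rightarrow> real"
      by (rule sum.mono_neutral_cong_right) (use p that in \<open>auto simp: \<gamma>_def\<close>)
    have "(\<Sum>j<Suc p0. (\<gamma> j)\<^sup>2) = (\<Sum>j\<in>J. (t j / s)\<^sup>2)"
      by (rule restrict) simp
    also have "\<dots> = (\<Sum>j\<in>J. (t j)\<^sup>2) / s\<^sup>2"
      by (simp add: power_divide sum_divide_distrib)
    also have "\<dots> = 1"
      using False by (simp add: s_def sum_nonneg)
    finally have \<gamma>: "\<gamma> \<in> unit_sphere (Suc p0)"
      by (simp add: unit_sphere_def vec_norm_def \<gamma>_def)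
    have "inner x (from_coords \<rho> (Suc p0) \<gamma>) = (\<Sum>j\<in>J. t j / s * inner x (\<rho> j))" for x
      unfolding inner_from_coords by (rule restrict) simp
    then have inner: "(\<Sum>j\<in>J. t j * inner x (\<rho> j)) = s * inner x (from_coords \<rho> (Suc p0) \<gamma>)" for x
      using False by (simp add: sum_distrib_left)
    have "(\<lambda>\<omega>. inner (X \<omega>) (from_coords \<rho> (Suc p0) \<gamma>)) \<in> borel_measurable M"
      by (rule measurable_inner_right[OF X])
    then show ?thesis
      unfolding inner
      by (rule integral_iexp_eq_0_if_cond_exp_given_eq_0[OF M _ Z zero[OF _ \<gamma>]]) simp
  qed
qed

text \<open>
  The weighted law of the coordinate sequence vanishes on cylinders by Fourier uniqueness, hence on all
  measurable sets of sequences, and these determine all Borel sets of the space.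
\<close>
proposition cond_exp_given_eq_0_if_sphere:
  fixes X :: "'a \<Rightarrow> 'h::real_inner" and Z :: "'a \<Rightarrow> real"
  assumes M: "prob_space M" and X: "X \<in> borel_measurable M" and Z: "integrable M Z"
    and mean: "(\<integral>\<omega>. Z \<omega> \<partial>M) = 0" and \<rho>: "orthonormal_basis \<rho>"
    and zero: "\<And>p \<gamma>. 1 \<le> p \<Longrightarrow> \<gamma> \<in> unit_sphere p \<Longrightarrow>
      AE \<omega> in M. cond_exp_given M Z (\<lambda>\<omega>. inner (X \<omega>) (from_coords \<rho> p \<gamma>)) \<omega> = 0"
  shows "AE \<omega> in M. cond_exp_given M Z X \<omega> = 0"
  unfolding cond_exp_given_eq_0_iff[OF M X Z]
proof
  fix B :: "'h set"
  assume "B \<in> sets borel"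
  then obtain C where C: "C \<in> sets (Pi\<^sub>M UNIV (\<lambda>_. borel))"
    and B: "B = {x. (\<lambda>j. inner x (\<rho> j)) \<in> C}"
    by (rule borel_set_determined_by_coordinates[OF \<rho>])
  have coord: "(\<lambda>\<omega>. inner (X \<omega>) (\<rho> j)) \<in> borel_measurable M" for j
    by (rule measurable_inner_right[OF X])
  have "(\<integral>\<omega>. Z \<omega> * indicator C (\<lambda>j. inner (X \<omega>) (\<rho> j)) \<partial>M) = 0"
  proof (rule integral_indicator_PiM_eq_0[OF coord Z _ C])
    fix J and B :: "nat \<Rightarrow> real set"
    assume J: "finite J" and B: "\<And>j. j \<in> J \<Longrightarrow> B j \<in> sets borel"
    have "(\<integral>\<omega>. complex_of_real (Z \<omega>) * (\<Prod>j\<in>J. indicator (B j) (inner (X \<omega>) (\<rho> j))) \<partial>M) = 0"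
      using Z integral_iexp_coordinates_eq_0[OF M X Z mean zero J]
      by (intro integral_prod_indicator_eq_0[OF J coord _ _ B]) auto
    also have "(\<integral>\<omega>. complex_of_real (Z \<omega>) * (\<Prod>j\<in>J. indicator (B j) (inner (X \<omega>) (\<rho> j))) \<partial>M)
        = (\<integral>\<omega>. complex_of_real (Z \<omega> * (\<Prod>j\<in>J. indicator (B j) (inner (X \<omega>) (\<rho> j)))) \<partial>M)"
      by (simp add: of_real_indicator)
    finally show "(\<integral>\<omega>. Z \<omega> * (\<Prod>j\<in>J. indicator (B j) (inner (X \<omega>) (\<rho> j))) \<partial>M) = 0"
      by (simp only: integral_complex_of_real of_real_eq_0_iff)
  qed
  then show "(\<integral>\<omega>. Z \<omega> * indicator B (X \<omega>) \<partial>M) = 0"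
    by (simp add: B indicator_def)
qed

section \<open>Null sets for the product Lebesgue measure\<close>

lemma Pi_lborel_translate:
  fixes a :: "'i \<Rightarrow> real"
  assumes I: "finite I"
  shows "distr (Pi\<^sub>M I (\<lambda>_. lborel)) (Pi\<^sub>M I (\<lambda>_. lborel)) (\<lambda>x. \<lambda>i\<in>I. x i + a i)
    = Pi\<^sub>M I (\<lambda>_. lborel)"
proof -
  interpret product_sigma_finite "\<lambda>_::'i. lborel :: real measure"
    by standard
  let ?L = "Pi\<^sub>M I (\<lambda>_. lborel :: real measure)"
  have shift: "(\<lambda>x. \<lambda>i\<in>I. x i + a i) \<in> ?L \<rightarrow>\<^sub>M ?L"
    by measurable
  show ?thesis
  proof (rule PiM_eqI[OF I])
    fix A assume A: "\<And>i. i \<in> I \<Longrightarrow> A i \<in> sets (lborel :: real measure)"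
    have preimage: "(+) (a i) -` A i \<in> sets lborel" if "i \<in> I" for i
      using measurable_sets[of "(+) (a i)" borel borel "A i"] A[OF that] by simp
    have invariant: "emeasure lborel ((+) (a i) -` A i) = emeasure lborel (A i)" if "i \<in> I" for i
      by (subst (2) lborel_distr_plus[of "a i", symmetric], subst emeasure_distr)
        (use A[OF that] in auto)
    have "Pi\<^sub>E I A \<in> sets ?L"
      using I A by (intro sets_PiM_I_finite) auto
    then have "emeasure (distr ?L ?L (\<lambda>x. \<lambda>i\<in>I. x i + a i)) (Pi\<^sub>E I A)
        = emeasure ?L ((\<lambda>x. \<lambda>i\<in>I. x i + a i) -` (Pi\<^sub>E I A) \<inter> space ?L)"
      by (rule emeasure_distr[OF shift])
    also have "(\<lambda>x. \<lambda>i\<in>I. x i + a i) -` (Pi\<^sub>E I A) \<inter> space ?L = Pi\<^sub>E I (\<lambda>i. (+) (a i) -` A i)"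
      by (auto simp: space_PiM PiE_iff add.commute)
    also have "emeasure ?L \<dots> = (\<Prod>i\<in>I. emeasure lborel ((+) (a i) -` A i))"
      using I preimage by (rule emeasure_PiM)
    also have "\<dots> = (\<Prod>i\<in>I. emeasure lborel (A i))"
      using invariant by (intro prod.cong) auto
    finally show "emeasure (distr ?L ?L (\<lambda>x. \<lambda>i\<in>I. x i + a i)) (Pi\<^sub>E I A)
        = (\<Prod>i\<in>I. emeasure lborel (A i))" .
  qed simp
qed

text \<open>
  Integrate the measure of the translate of \<open>N\<close> by \<open>- s d\<close> over all \<open>s\<close>. By translation invariance
  the result is infinity times the measure of \<open>N\<close>; by Fubini it is the integral over \<open>x\<close> of
  the length of the trace of \<open>N\<close> on the line through \<open>x\<close> in direction \<open>d\<close>, which is zero.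
\<close>
lemma null_set_if_null_on_parallel_lines:
  fixes d :: "'i \<Rightarrow> real"
  assumes I: "finite I" and N: "N \<in> sets (Pi\<^sub>M I (\<lambda>_. lborel))"
    and lines: "\<And>x. {s. (\<lambda>i\<in>I. x i + s * d i) \<in> N} \<in> null_sets lborel"
  shows "N \<in> null_sets (Pi\<^sub>M I (\<lambda>_. lborel))"
proof -
  interpret product_sigma_finite "\<lambda>_::'i. lborel :: real measure"
    by standard
  let ?L = "Pi\<^sub>M I (\<lambda>_. lborel :: real measure)"
  interpret L: sigma_finite_measure ?L
    by (rule sigma_finite[OF I])
  interpret pair_sigma_finite ?L "lborel :: real measure"
    by standard
  have "(\<lambda>p. \<lambda>i\<in>I. fst p i + snd p * d i) \<in> ?L \<Otimes>\<^sub>M lborel \<rightarrow>\<^sub>M ?L"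
    by measurable
  then have meas: "(\<lambda>(x, s). indicator N (\<lambda>i\<in>I. x i + s * d i) :: ennreal)
      \<in> borel_measurable (?L \<Otimes>\<^sub>M lborel)"
    using N by (auto simp: case_prod_beta' intro!: measurable_compose[OF _ borel_measurable_indicator])
  have "(\<integral>\<^sup>+s. \<integral>\<^sup>+x. indicator N (\<lambda>i\<in>I. x i + s * d i) \<partial>?L \<partial>lborel) = (\<integral>\<^sup>+(s::real). emeasure ?L N \<partial>lborel)"
  proof (rule nn_integral_cong)
    fix s :: real
    have "(\<integral>\<^sup>+x. indicator N (\<lambda>i\<in>I. x i + s * d i) \<partial>?L)
        = (\<integral>\<^sup>+x. indicator N x \<partial>distr ?L ?L (\<lambda>x. \<lambda>i\<in>I. x i + s * d i))"
      using N by (subst nn_integral_distr) auto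
    also have "\<dots> = emeasure ?L N"
      using N by (subst Pi_lborel_translate[OF I, of "\<lambda>i. s * d i"]) simp
    finally show "(\<integral>\<^sup>+x. indicator N (\<lambda>i\<in>I. x i + s * d i) \<partial>?L) = emeasure ?L N" .
  qed
  moreover have "(\<integral>\<^sup>+s. \<integral>\<^sup>+x. indicator N (\<lambda>i\<in>I. x i + s * d i) \<partial>?L \<partial>lborel)
      = (\<integral>\<^sup>+x. \<integral>\<^sup>+s. indicator N (\<lambda>i\<in>I. x i + s * d i) \<partial>lborel \<partial>?L)"
    by (rule Fubini'[OF meas])
  moreover have "(\<integral>\<^sup>+s. indicator N (\<lambda>i\<in>I. x i + s * d i) \<partial>lborel) = 0" for x
  proof -
    have "(\<integral>\<^sup>+s. indicator N (\<lambda>i\<in>I. x i + s * d i) \<partial>lborel)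
        = (\<integral>\<^sup>+s. indicator {s. (\<lambda>i\<in>I. x i + s * d i) \<in> N} s \<partial>lborel)"
      by (intro nn_integral_cong) (simp add: indicator_def)
    also have "\<dots> = 0"
      using lines[of x] by (subst nn_integral_indicator) auto
    finally show ?thesis .
  qed
  ultimately have "emeasure ?L N * \<infinity> = 0"
    by (simp add: emeasure_lborel_UNIV)
  then show ?thesis
    using N by (auto simp: null_sets_def)
qed

section \<open>Directional moments\<close>

lemma integrable_mult_power_bounded:
  fixes X :: "'a \<Rightarrow> 'h::real_inner" and Z g :: "'a \<Rightarrow> real"
  assumes exp: "\<And>s. s > 0 \<Longrightarrow> integrable M (\<lambda>\<omega>. \<bar>Z \<omega>\<bar> * exp (s * norm (X \<omega>)))"
    and Z[measurable]: "Z \<in> borel_measurable M" and g[measurable]: "g \<in> borel_measurable M"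
    and bound: "\<And>\<omega>. \<bar>g \<omega>\<bar> \<le> c * norm (X \<omega>) ^ k"
  shows "integrable M (\<lambda>\<omega>. Z \<omega> * g \<omega>)"
proof (rule Bochner_Integration.integrable_bound)
  \<comment> \<open>A power is bounded by an exponential: \<open>y\<^sup>k \<le> exp(k y)\<close> for \<open>y \<ge> 0\<close>.
    The exponent is raised to \<open>k + 1\<close> so that it is positive when \<open>k = 0\<close>.\<close>
  show "integrable M (\<lambda>\<omega>. \<bar>c\<bar> * (\<bar>Z \<omega>\<bar> * exp (real (Suc k) * norm (X \<omega>))))"
    by (intro integrable_mult_right exp) simp
  have "norm (Z \<omega> * g \<omega>) \<le> norm (\<bar>c\<bar> * (\<bar>Z \<omega>\<bar> * exp (real (Suc k) * norm (X \<omega>))))" for \<omega>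
  proof -
    have "norm (X \<omega>) \<le> exp (norm (X \<omega>))"
      using exp_ge_add_one_self[of "norm (X \<omega>)"] by linarith
    then have "norm (X \<omega>) ^ k \<le> exp (norm (X \<omega>)) ^ k"
      by (rule power_mono) simp
    also have "\<dots> \<le> exp (real (Suc k) * norm (X \<omega>))"
      by (subst exp_of_nat_mult[symmetric]) (simp add: mult_right_mono)
    finally have "c * norm (X \<omega>) ^ k \<le> \<bar>c\<bar> * exp (real (Suc k) * norm (X \<omega>))"
      by (intro mult_mono) auto
    then have "\<bar>g \<omega>\<bar> \<le> \<bar>c\<bar> * exp (real (Suc k) * norm (X \<omega>))"
      using bound[of \<omega>] by linarith
    then have "\<bar>Z \<omega>\<bar> * \<bar>g \<omega>\<bar> \<le> \<bar>Z \<omega>\<bar> * (\<bar>c\<bar> * exp (real (Suc k) * norm (X \<omega>)))"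
      by (intro mult_left_mono) auto
    then show ?thesis
      by (simp add: abs_mult mult_ac)
  qed
  then show "AE \<omega> in M. norm (Z \<omega> * g \<omega>) \<le> norm (\<bar>c\<bar> * (\<bar>Z \<omega>\<bar> * exp (real (Suc k) * norm (X \<omega>))))"
    by simp
qed measurable

definition directional_moment ::
    "'a measure \<Rightarrow> ('a \<Rightarrow> real) \<Rightarrow> ('a \<Rightarrow> 'h::real_inner) \<Rightarrow> nat \<Rightarrow> 'h \<Rightarrow> real" where
  "directional_moment M Z X k v = (\<integral>\<omega>. Z \<omega> * inner (X \<omega>) v ^ k \<partial>M)"

lemma directional_moment_scaleR:
  "directional_moment M Z X k (c *\<^sub>R v) = c ^ k * directional_moment M Z X k v"
  unfolding directional_moment_def integral_mult_right_zero[symmetric]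
  by (simp add: power_mult_distrib mult_ac)

lemma abs_inner_power_le: "\<bar>inner x v ^ k\<bar> \<le> norm v ^ k * norm x ^ k"
  using Cauchy_Schwarz_ineq2[of x v]
  by (simp add: power_abs flip: power_mult_distrib) (auto intro!: power_mono simp: mult.commute)

text \<open>
  In coordinates the moment is a polynomial of the direction: the \<open>k\<close>-th power of a sum over
  \<open>j < p\<close> expands into a sum over all maps from \<open>{..<k}\<close> to \<open>{..<p}\<close>. Continuity and
  measurability in the direction are read off from this form.
\<close>
lemma directional_moment_from_coords:
  fixes X :: "'a \<Rightarrow> 'h::real_inner" and Z :: "'a \<Rightarrow> real"
  assumes exp: "\<And>s. s > 0 \<Longrightarrow> integrable M (\<lambda>\<omega>. \<bar>Z \<omega>\<bar> * exp (s * norm (X \<omega>)))"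
    and Z: "Z \<in> borel_measurable M" and X: "X \<in> borel_measurable M"
  shows "directional_moment M Z X k (from_coords \<rho> p \<gamma>)
    = (\<Sum>f\<in>{..<k} \<rightarrow>\<^sub>E {..<p}. (\<Prod>i<k. \<gamma> (f i)) * (\<integral>\<omega>. Z \<omega> * (\<Prod>i<k. inner (X \<omega>) (\<rho> (f i))) \<partial>M))"
proof -
  note [measurable] = Z measurable_inner_right[OF X]
  have int: "integrable M (\<lambda>\<omega>. Z \<omega> * (\<Prod>i<k. inner (X \<omega>) (\<rho> (f i))))" for f :: "nat \<Rightarrow> nat"
  proof (rule integrable_mult_power_bounded[OF exp Z])
    fix \<omega>
    have "\<bar>\<Prod>i<k. inner (X \<omega>) (\<rho> (f i))\<bar> \<le> (\<Prod>i<k. norm (\<rho> (f i)) * norm (X \<omega>))"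
      unfolding abs_prod
      by (intro prod_mono conjI abs_ge_zero, subst mult.commute, rule Cauchy_Schwarz_ineq2)
    then show "\<bar>\<Prod>i<k. inner (X \<omega>) (\<rho> (f i))\<bar> \<le> (\<Prod>i<k. norm (\<rho> (f i))) * norm (X \<omega>) ^ k"
      by (simp add: prod.distrib)
  qed auto
  have expand: "inner x (from_coords \<rho> p \<gamma>) ^ k
      = (\<Sum>f\<in>{..<k} \<rightarrow>\<^sub>E {..<p}. (\<Prod>i<k. \<gamma> (f i)) * (\<Prod>i<k. inner x (\<rho> (f i))))" for x
  proof -
    have "inner x (from_coords \<rho> p \<gamma>) ^ k = (\<Prod>i<k. \<Sum>j<p. \<gamma> j * inner x (\<rho> j))"
      by (simp add: from_coords_def inner_sum_right)
    also have "\<dots> = (\<Sum>f\<in>{..<k} \<rightarrow>\<^sub>E {..<p}. \<Prod>i<k. \<gamma> (f i) * inner x (\<rho> (f i)))"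
      by (rule prod_sum_PiE) auto
    finally show ?thesis
      by (simp add: prod.distrib)
  qed
  have "directional_moment M Z X k (from_coords \<rho> p \<gamma>)
      = (\<integral>\<omega>. (\<Sum>f\<in>{..<k} \<rightarrow>\<^sub>E {..<p}. (\<Prod>i<k. \<gamma> (f i)) * (Z \<omega> * (\<Prod>i<k. inner (X \<omega>) (\<rho> (f i))))) \<partial>M)"
    by (simp add: directional_moment_def expand sum_distrib_left mult.left_commute)
  also have "\<dots> = (\<Sum>f\<in>{..<k} \<rightarrow>\<^sub>E {..<p}. (\<Prod>i<k. \<gamma> (f i)) * (\<integral>\<omega>. Z \<omega> * (\<Prod>i<k. inner (X \<omega>) (\<rho> (f i))) \<partial>M))"
    by (subst Bochner_Integration.integral_sum) (auto intro!: integrable_mult_right int)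
  finally show ?thesis .
qed

text \<open>
  By the binomial theorem the moment is a polynomial of degree \<open>k\<close> in \<open>s\<close>, and the coefficient of
  \<open>s\<^sup>k\<close> is the moment of \<open>v\<close>, whatever the base point \<open>u\<close>.
\<close>
lemma finite_directional_moment_roots_on_line:
  fixes X :: "'a \<Rightarrow> 'h::real_inner" and Z :: "'a \<Rightarrow> real"
  assumes exp: "\<And>s. s > 0 \<Longrightarrow> integrable M (\<lambda>\<omega>. \<bar>Z \<omega>\<bar> * exp (s * norm (X \<omega>)))"
    and Z: "Z \<in> borel_measurable M" and X: "X \<in> borel_measurable M"
    and v: "directional_moment M Z X k v \<noteq> 0"
  shows "finite {s. directional_moment M Z X k (u + s *\<^sub>R v) = 0}"
proof -
  note [measurable] = Z measurable_inner_right[OF X]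
  define c where "c j = real (k choose j) * (\<integral>\<omega>. Z \<omega> * (inner (X \<omega>) v ^ j * inner (X \<omega>) u ^ (k - j)) \<partial>M)" for j
  have int: "integrable M (\<lambda>\<omega>. Z \<omega> * (inner (X \<omega>) v ^ j * inner (X \<omega>) u ^ (k - j)))" if "j \<le> k" for j
  proof (rule integrable_mult_power_bounded[OF exp Z])
    fix \<omega>
    have "\<bar>inner (X \<omega>) v ^ j * inner (X \<omega>) u ^ (k - j)\<bar>
        \<le> (norm v ^ j * norm (X \<omega>) ^ j) * (norm u ^ (k - j) * norm (X \<omega>) ^ (k - j))"
      unfolding abs_mult by (intro mult_mono abs_inner_power_le) auto
    also have "\<dots> = norm v ^ j * norm u ^ (k - j) * norm (X \<omega>) ^ k"
      using that by (simp flip: power_add)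
    finally show "\<bar>inner (X \<omega>) v ^ j * inner (X \<omega>) u ^ (k - j)\<bar>
        \<le> norm v ^ j * norm u ^ (k - j) * norm (X \<omega>) ^ k" .
  qed auto
  have "directional_moment M Z X k (u + s *\<^sub>R v) = (\<Sum>j\<le>k. c j * s ^ j)" for s
  proof -
    have "inner x (u + s *\<^sub>R v) ^ k
        = (\<Sum>j\<le>k. (real (k choose j) * s ^ j) * (inner x v ^ j * inner x u ^ (k - j)))" for x
      using binomial_ring[of "s * inner x v" "inner x u" k]
      by (simp add: inner_add_right power_mult_distrib mult_ac add.commute)
    then have "directional_moment M Z X k (u + s *\<^sub>R v)
        = (\<integral>\<omega>. (\<Sum>j\<le>k. (real (k choose j) * s ^ j) * (Z \<omega> * (inner (X \<omega>) v ^ j * inner (X \<omega>) u ^ (k - j)))) \<partial>M)"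
      by (simp add: directional_moment_def sum_distrib_left mult.left_commute)
    also have "\<dots> = (\<Sum>j\<le>k. (real (k choose j) * s ^ j)
        * (\<integral>\<omega>. Z \<omega> * (inner (X \<omega>) v ^ j * inner (X \<omega>) u ^ (k - j)) \<partial>M))"
      by (subst Bochner_Integration.integral_sum) (auto intro!: integrable_mult_right int)
    also have "\<dots> = (\<Sum>j\<le>k. c j * s ^ j)"
      by (simp only: c_def mult_ac)
    finally show ?thesis .
  qed
  moreover have "c k \<noteq> 0"
    using v by (simp add: c_def directional_moment_def)
  ultimately show ?thesis
    using polyfun_finite_roots[of c k] by auto
qed

text \<open>
  The partial sums of the exponential series, multiplied by \<open>Z\<close>, are dominated by
  \<open>\<bar>Z\<bar> exp(\<bar>t\<bar> \<bar>\<langle>X, v\<rangle>\<bar>)\<close>, hence by an integrable function, and their integrals are combinations of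
  moments.
\<close>
lemma integral_iexp_eq_0_if_moments_eq_0:
  fixes X :: "'a \<Rightarrow> 'h::real_inner" and Z :: "'a \<Rightarrow> real"
  assumes exp: "\<And>s. s > 0 \<Longrightarrow> integrable M (\<lambda>\<omega>. \<bar>Z \<omega>\<bar> * exp (s * norm (X \<omega>)))"
    and Z: "Z \<in> borel_measurable M" and X: "X \<in> borel_measurable M"
    and moments: "\<And>k. directional_moment M Z X k v = 0"
  shows "(\<integral>\<omega>. complex_of_real (Z \<omega>) * iexp (t * inner (X \<omega>) v) \<partial>M) = 0"
proof -
  note [measurable] = Z measurable_inner_right[OF X]
  let ?term = "\<lambda>m y. (\<i> * complex_of_real (t * y)) ^ m /\<^sub>R fact m"
  let ?w = "\<lambda>\<omega>. \<bar>Z \<omega>\<bar> * exp ((\<bar>t\<bar> * norm v + 1) * norm (X \<omega>))"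
  have moment_int: "integrable M (\<lambda>\<omega>. Z \<omega> * inner (X \<omega>) v ^ m)" for m
    by (rule integrable_mult_power_bounded[OF exp Z _ abs_inner_power_le]) auto
  have partial_int: "(\<integral>\<omega>. complex_of_real (Z \<omega>) * (\<Sum>m<n. ?term m (inner (X \<omega>) v)) \<partial>M) = 0" for n
  proof -
    have "complex_of_real (Z \<omega>) * (\<Sum>m<n. ?term m (inner (X \<omega>) v))
        = (\<Sum>m<n. ((\<i> * complex_of_real t) ^ m /\<^sub>R fact m) * complex_of_real (Z \<omega> * inner (X \<omega>) v ^ m))" for \<omega>
      by (simp add: sum_distrib_left power_mult_distrib scaleR_conv_of_real mult_ac)
    then have "(\<integral>\<omega>. complex_of_real (Z \<omega>) * (\<Sum>m<n. ?term m (inner (X \<omega>) v)) \<partial>M)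
        = (\<integral>\<omega>. (\<Sum>m<n. ((\<i> * complex_of_real t) ^ m /\<^sub>R fact m) * complex_of_real (Z \<omega> * inner (X \<omega>) v ^ m)) \<partial>M)"
      by simp
    also have "\<dots> = (\<Sum>m<n. ((\<i> * complex_of_real t) ^ m /\<^sub>R fact m)
        * complex_of_real (directional_moment M Z X m v))"
      unfolding directional_moment_def
      by (subst Bochner_Integration.integral_sum)
        (auto intro!: integrable_mult_right integrable_of_real moment_int simp del: of_real_mult of_real_power
          simp: integral_complex_of_real)
    finally show ?thesis
      by (simp add: moments)
  qed
  have "(\<lambda>n. \<integral>\<omega>. complex_of_real (Z \<omega>) * (\<Sum>m<n. ?term m (inner (X \<omega>) v)) \<partial>M)
      \<longlonglongrightarrow> (\<integral>\<omega>. complex_of_real (Z \<omega>) * iexp (t * inner (X \<omega>) v) \<partial>M)"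
  proof (rule integral_dominated_convergence)
    \<comment> \<open>The summand \<open>1\<close> in the exponent of \<open>?w\<close> keeps it positive when \<open>t = 0\<close> or \<open>v = 0\<close>.\<close>
    show "integrable M ?w"
      by (rule exp) (simp add: add_nonneg_pos)
    show "AE \<omega> in M. (\<lambda>n. complex_of_real (Z \<omega>) * (\<Sum>m<n. ?term m (inner (X \<omega>) v)))
        \<longlonglongrightarrow> complex_of_real (Z \<omega>) * iexp (t * inner (X \<omega>) v)"
      using exp_converges[of "\<i> * complex_of_real (t * _)"]
      by (intro AE_I2 tendsto_mult tendsto_const) (auto simp: sums_def)
    show "AE \<omega> in M. norm (complex_of_real (Z \<omega>) * (\<Sum>m<n. ?term m (inner (X \<omega>) v))) \<le> ?w \<omega>" for n
    proof (rule AE_I2)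
      fix \<omega>
      let ?y = "inner (X \<omega>) v"
      have "norm (\<Sum>m<n. ?term m ?y) \<le> (\<Sum>m<n. \<bar>t * ?y\<bar> ^ m /\<^sub>R fact m)"
        by (rule sum_norm_le) (simp add: norm_mult norm_power power_mult_distrib abs_mult)
      also have "\<dots> \<le> exp \<bar>t * ?y\<bar>"
        unfolding exp_def by (rule sum_le_suminf[OF summable_exp_generic]) auto
      also have "\<dots> \<le> exp ((\<bar>t\<bar> * norm v + 1) * norm (X \<omega>))"
      proof -
        have "\<bar>t * ?y\<bar> \<le> \<bar>t\<bar> * (norm (X \<omega>) * norm v)"
          unfolding abs_mult by (intro mult_left_mono Cauchy_Schwarz_ineq2) auto
        also have "\<dots> \<le> (\<bar>t\<bar> * norm v + 1) * norm (X \<omega>)"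
          by (simp add: algebra_simps)
        finally show ?thesis
          by simp
      qed
      finally show "norm (complex_of_real (Z \<omega>) * (\<Sum>m<n. ?term m ?y)) \<le> ?w \<omega>"
        unfolding norm_mult norm_of_real by (intro mult_left_mono) auto
    qed
  qed measurable
  then show ?thesis
    unfolding partial_int by (simp add: LIMSEQ_const_iff)
qed

section \<open>Exceptional directions on the sphere\<close>

lemma continuous_map_directional_moment:
  fixes X :: "'a \<Rightarrow> 'h::real_inner" and Z :: "'a \<Rightarrow> real"
  assumes exp: "\<And>s. s > 0 \<Longrightarrow> integrable M (\<lambda>\<omega>. \<bar>Z \<omega>\<bar> * exp (s * norm (X \<omega>)))"
    and Z: "Z \<in> borel_measurable M" and X: "X \<in> borel_measurable M"
  shows "continuous_map (product_topology (\<lambda>_. euclideanreal) {..<p}) euclideanreal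
    (\<lambda>\<gamma>. directional_moment M Z X k (from_coords \<rho> p \<gamma>))"
proof -
  have expand: "directional_moment M Z X k (from_coords \<rho> p \<gamma>)
      = (\<Sum>f\<in>{..<k} \<rightarrow>\<^sub>E {..<p}. (\<Prod>i<k. \<gamma> (f i)) * (\<integral>\<omega>. Z \<omega> * (\<Prod>i<k. inner (X \<omega>) (\<rho> (f i))) \<partial>M))" for \<gamma>
    by (rule directional_moment_from_coords[OF exp Z X])
  show ?thesis
    unfolding expand
    by (intro continuous_map_sum continuous_map_real_mult continuous_map_prod
        continuous_map_product_coordinates   continuous_map_canonical_const finite_PiE) auto
qed

lemma borel_measurable_directional_moment:
  fixes X :: "'a \<Rightarrow> 'h::real_inner" and Z :: "'a \<Rightarrow> real"
  assumes exp: "\<And>s. s > 0 \<Longrightarrow> integrable M (\<lambda>\<omega>. \<bar>Z \<omega>\<bar> * exp (s * norm (X \<omega>)))"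
    and Z: "Z \<in> borel_measurable M" and X: "X \<in> borel_measurable M"
  shows "(\<lambda>\<gamma>. directional_moment M Z X k (from_coords \<rho> p \<gamma>)) \<in> borel_measurable (Pi\<^sub>M {..<p} (\<lambda>_. borel))"
proof -
  have expand: "directional_moment M Z X k (from_coords \<rho> p \<gamma>)
      = (\<Sum>f\<in>{..<k} \<rightarrow>\<^sub>E {..<p}. (\<Prod>i<k. \<gamma> (f i)) * (\<integral>\<omega>. Z \<omega> * (\<Prod>i<k. inner (X \<omega>) (\<rho> (f i))) \<partial>M))" for \<gamma>
    by (rule directional_moment_from_coords[OF exp Z X])
  show ?thesis
    unfolding expand
    by (intro borel_measurable_sum borel_measurable_times borel_measurable_prod
          measurable_component_singleton borel_measurable_const) auto
qed

text \<open>
  The surface measure of a set is a multiple of the volume of the cone over it, and by homogeneity that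
  cone again consists of zeros of the moment. In the ambient space these zeros can be counted on lines
  parallel to \<open>\<gamma>0\<close>.
\<close>
lemma directional_moment_zero_set:
  fixes X :: "'a \<Rightarrow> 'h::real_inner" and Z :: "'a \<Rightarrow> real"
  assumes exp: "\<And>s. s > 0 \<Longrightarrow> integrable M (\<lambda>\<omega>. \<bar>Z \<omega>\<bar> * exp (s * norm (X \<omega>)))"
    and Z: "Z \<in> borel_measurable M" and X: "X \<in> borel_measurable M"
    and \<gamma>0: "\<gamma>0 \<in> unit_sphere p" "directional_moment M Z X k (from_coords \<rho> p \<gamma>0) \<noteq> 0"
    and A: "A \<subseteq> {\<gamma> \<in> unit_sphere p. directional_moment M Z X k (from_coords \<rho> p \<gamma>) = 0}"
  shows "A \<in> null_sets (sphere_lebesgue p)" and "\<not> dense_in_sphere p A"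
proof -
  let ?m = "\<lambda>\<gamma>. directional_moment M Z X k (from_coords \<rho> p \<gamma>)"
  let ?L = "Pi\<^sub>M {..<p} (\<lambda>_. lborel :: real measure)"
  let ?B = "Pi\<^sub>M {..<p} (\<lambda>_. borel :: real measure)"
  let ?A = "{\<gamma> \<in> unit_sphere p. ?m \<gamma> = 0}"
  let ?N = "{x \<in> space ?B. ?m x = 0}"
  note [measurable] = borel_measurable_directional_moment[OF exp Z X, of k \<rho> p]
  have sets_eq: "sets ?L = sets ?B"
    by (intro sets_PiM_cong) auto
  have N: "?N \<in> sets ?B"
    by measurable
  have null: "?N \<in> null_sets ?L"
  proof (rule null_set_if_null_on_parallel_lines)
    show "?N \<in> sets ?L"
      using N sets_eq by simp
    fix x :: "nat \<Rightarrow> real"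
    have "from_coords \<rho> p (\<lambda>i\<in>{..<p}. x i + s * \<gamma>0 i) = from_coords \<rho> p x + s *\<^sub>R from_coords \<rho> p \<gamma>0" for s
      by (simp add: from_coords_def scaleR_add_left sum.distrib scaleR_sum_right)
    then have "{s. (\<lambda>i\<in>{..<p}. x i + s * \<gamma>0 i) \<in> ?N}
        = {s. directional_moment M Z X k (from_coords \<rho> p x + s *\<^sub>R from_coords \<rho> p \<gamma>0) = 0}"
      by (auto simp: space_PiM)
    also have "finite \<dots>"
      by (rule finite_directional_moment_roots_on_line[OF exp Z X \<gamma>0(2)])
    finally show "{s. (\<lambda>i\<in>{..<p}. x i + s * \<gamma>0 i) \<in> ?N} \<in> null_sets lborel"
      by (rule finite_imp_null_set_lborel)
  qed simp
  have "?A = unit_sphere p \<inter> ?N"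
    by (auto simp: unit_sphere_def space_PiM)
  then have A_sets: "?A \<in> sets (restrict_space ?B (unit_sphere p))"
    using N by (auto simp: sets_restrict_space)
  have "{x \<in> punctured_ball p. radial_projection p x \<in> ?A} \<subseteq> ?N"
  proof safe
    fix x
    assume x: "x \<in> punctured_ball p" and zero: "?m (radial_projection p x) = 0"
    have "from_coords \<rho> p x = vec_norm p x *\<^sub>R from_coords \<rho> p (radial_projection p x)"
      using x by (simp add: from_coords_def radial_projection_def punctured_ball_def scaleR_sum_right)
    then show "?m x = 0"
      using zero by (simp add: directional_moment_scaleR)
    show "x \<in> space ?B"
      using x by (simp add: punctured_ball_def space_PiM)
  qed
  then have "emeasure ?L {x \<in> punctured_ball p. radial_projection p x \<in> ?A} \<le> emeasure ?L ?N"
    using null by (intro emeasure_mono) auto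
  also have "\<dots> = 0"
    using null by (rule null_setsD1)
  finally have "emeasure ?L {x \<in> punctured_ball p. radial_projection p x \<in> ?A} = 0"
    by simp
  then have "emeasure (sphere_borel_measure p) ?A = 0"
    using sphere_borel_measure_eq_cone[OF A_sets] by simp
  then have "?A \<in> null_sets (sphere_borel_measure p)"
    using A_sets by (simp add: null_sets_def sphere_borel_measure_def)
  then show "A \<in> null_sets (sphere_lebesgue p)"
    unfolding sphere_lebesgue_def using A
    by (intro null_sets_completion_subset[OF A] null_sets_completionI)
  let ?T = "subtopology (product_topology (\<lambda>_. euclideanreal) {..<p}) (unit_sphere p)"
  have top: "topspace ?T = unit_sphere p"
    by (auto simp: unit_sphere_def)
  have "continuous_map ?T euclideanreal ?m"
    by (intro continuous_map_from_subtopology continuous_map_directional_moment[OF exp Z X])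
  then have "closedin ?T {\<gamma> \<in> topspace ?T. ?m \<gamma> \<in> {0}}"
    by (rule closedin_continuous_map_preimage) simp
  then have "closedin ?T ?A"
    unfolding top by simp
  then have "?T closure_of A \<subseteq> ?A"
    using A by (intro closure_of_minimal)
  then show "\<not> dense_in_sphere p A"
    using \<gamma>0 by (auto simp: dense_in_sphere_def)
qed

text \<open>
  The moment problem for the projection is determinate under exponential integrability: if all moments
  vanished, so would the Fourier transform and with it the weighted law.
\<close>
lemma exists_directional_moment_nonzero:
  fixes X :: "'a \<Rightarrow> 'h::real_inner" and Z :: "'a \<Rightarrow> real"
  assumes M: "prob_space M"
    and exp: "\<And>s. s > 0 \<Longrightarrow> integrable M (\<lambda>\<omega>. \<bar>Z \<omega>\<bar> * exp (s * norm (X \<omega>)))"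
    and Z: "integrable M Z" and X: "X \<in> borel_measurable M"
    and nonzero: "\<not> (AE \<omega> in M. cond_exp_given M Z (\<lambda>\<omega>. inner (X \<omega>) v) \<omega> = 0)"
  shows "\<exists>k. directional_moment M Z X k v \<noteq> 0"
proof (rule ccontr)
  assume "\<nexists>k. directional_moment M Z X k v \<noteq> 0"
  then have moments: "\<And>k. directional_moment M Z X k v = 0"
    by blast
  note Y = measurable_inner_right[OF X, of v]
  have "(\<integral>\<omega>. Z \<omega> * indicator B (inner (X \<omega>) v) \<partial>M) = 0" if "B \<in> sets borel" for B
    using integral_iexp_eq_0_if_moments_eq_0[OF exp borel_measurable_integrable[OF Z] X moments]
    by (intro integral_indicator_eq_0_real[OF Y Z _ that]) auto
  then show False
    using nonzero cond_exp_given_eq_0_iff[OF M Y Z] by blast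
qed

lemma directional_moment_eq_0_if_cond_exp_given_eq_0:
  fixes X :: "'a \<Rightarrow> 'h::real_inner" and Z :: "'a \<Rightarrow> real"
  assumes M: "prob_space M"
    and exp: "\<And>s. s > 0 \<Longrightarrow> integrable M (\<lambda>\<omega>. \<bar>Z \<omega>\<bar> * exp (s * norm (X \<omega>)))"
    and Z: "integrable M Z" and X: "X \<in> borel_measurable M"
    and zero: "AE \<omega> in M. cond_exp_given M Z (\<lambda>\<omega>. inner (X \<omega>) v) \<omega> = 0"
  shows "directional_moment M Z X k v = 0"
proof -
  note [measurable] = measurable_inner_right[OF X, of v]
  have "integrable M (\<lambda>\<omega>. Z \<omega> * inner (X \<omega>) v ^ k)"
    by (rule integrable_mult_power_bounded[OF exp borel_measurable_integrable[OF Z] _ abs_inner_power_le]) auto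
  then have "(\<integral>\<omega>. inner (X \<omega>) v ^ k * Z \<omega> \<partial>M) = 0"
    by (intro cond_exp_given_eq_0_integral[OF M _ Z zero]) (auto simp: mult.commute)
  then show ?thesis
    by (simp add: directional_moment_def mult.commute)
qed

lemma unit_sphere_pad_zeros:
  assumes \<gamma>: "\<gamma> \<in> unit_sphere p" and "p \<le> q"
  shows "\<exists>\<gamma>'\<in>unit_sphere q. from_coords \<rho> q \<gamma>' = from_coords \<rho> p \<gamma>"
proof
  let ?\<gamma> = "\<lambda>j\<in>{..<q}. if j < p then \<gamma> j else 0"
  have "(\<Sum>j<q. (?\<gamma> j)\<^sup>2) = (\<Sum>j<p. (\<gamma> j)\<^sup>2)"
    by (rule sum.mono_neutral_cong_right) (use \<open>p \<le> q\<close> in auto)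
  then show "?\<gamma> \<in> unit_sphere q"
    using \<gamma> by (simp add: unit_sphere_def vec_norm_def)
  show "from_coords \<rho> q ?\<gamma> = from_coords \<rho> p \<gamma>"
    unfolding from_coords_def
    by (rule sum.mono_neutral_cong_right) (use \<open>p \<le> q\<close> in auto)
qed

text \<open>
  A direction with \<open>E(Z | \<langle>X, \<gamma>0\<rangle>) \<noteq> 0\<close> persists in higher dimensions by padding with zeros and has
  a nonzero moment of some order \<open>k\<close>; at exceptional directions this moment vanishes. One fixed \<open>k\<close>
  therefore separates \<open>\<gamma>0\<close> from all exceptional directions.
\<close>
proposition cond_exp_given_eq_0_directions_negligible:
  fixes X :: "'a \<Rightarrow> 'h::real_inner" and Z :: "'a \<Rightarrow> real"
  assumes M: "prob_space M"
    and exp: "\<And>s. s > 0 \<Longrightarrow> integrable M (\<lambda>\<omega>. \<bar>Z \<omega>\<bar> * exp (s * norm (X \<omega>)))"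
    and Z: "integrable M Z" and X: "X \<in> borel_measurable M"
    and \<gamma>0: "\<gamma>0 \<in> unit_sphere p0"
      "\<not> (AE \<omega> in M. cond_exp_given M Z (\<lambda>\<omega>. inner (X \<omega>) (from_coords \<rho> p0 \<gamma>0)) \<omega> = 0)"
    and "p0 \<le> p"
  defines "A \<equiv> {\<gamma> \<in> unit_sphere p.
    AE \<omega> in M. cond_exp_given M Z (\<lambda>\<omega>. inner (X \<omega>) (from_coords \<rho> p \<gamma>)) \<omega> = 0}"
  shows "A \<in> null_sets (sphere_lebesgue p)" and "\<not> dense_in_sphere p A"
proof -
  obtain \<gamma>1 where \<gamma>1: "\<gamma>1 \<in> unit_sphere p" "from_coords \<rho> p \<gamma>1 = from_coords \<rho> p0 \<gamma>0"
    using unit_sphere_pad_zeros[OF \<gamma>0(1) \<open>p0 \<le> p\<close>] by blast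
  then obtain k where k: "directional_moment M Z X k (from_coords \<rho> p \<gamma>1) \<noteq> 0"
    using exists_directional_moment_nonzero[OF M exp Z X \<gamma>0(2)] by auto
  have "A \<subseteq> {\<gamma> \<in> unit_sphere p. directional_moment M Z X k (from_coords \<rho> p \<gamma>) = 0}"
    unfolding A_def using directional_moment_eq_0_if_cond_exp_given_eq_0[OF M exp Z X] by blast
  then show "A \<in> null_sets (sphere_lebesgue p)" and "\<not> dense_in_sphere p A"
    using directional_moment_zero_set[OF exp borel_measurable_integrable[OF Z] X \<gamma>1(1) k] by blast+
qed

theorem lemma1:
  fixes M :: "'a measure" and X :: "'a \<Rightarrow> L2_unit" and Z :: "'a \<Rightarrow> real"
    and \<rho> :: "nat \<Rightarrow> L2_unit"
  assumes "prob_space M"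
    and "X \<in> borel_measurable M"
    and "Z \<in> borel_measurable M"
    and "integrable M Z"
    and "integral\<^sup>L M Z = 0"
    and "orthonormal_basis \<rho>"
  shows
    "((AE \<omega> in M. cond_exp_given M Z X \<omega> = 0) \<longleftrightarrow>
        (\<forall>\<beta>::L2_unit. norm \<beta> = 1 \<longrightarrow>
           (AE \<omega> in M. cond_exp_given M Z (\<lambda>\<omega>. inner (X \<omega>) \<beta>) \<omega> = 0)))
     \<and> ((AE \<omega> in M. cond_exp_given M Z X \<omega> = 0) \<longleftrightarrow>
        (\<forall>p\<ge>1. \<forall>\<gamma>\<in>unit_sphere p.
           (AE \<omega> in M. cond_exp_given M Z (\<lambda>\<omega>. inner (X \<omega>) (from_coords \<rho> p \<gamma>)) \<omega> = 0)))
     \<and> ((AE \<omega> in M. cond_exp_given M Z X \<omega> = 0) \<longleftrightarrow>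
        (\<forall>p\<ge>1. (AE \<omega> in M. cond_exp_given M Z (\<lambda>\<omega>. truncation \<rho> p (X \<omega>)) \<omega> = 0)))
     \<and> ((\<forall>s>0. integrable M (\<lambda>\<omega>. \<bar>Z \<omega>\<bar> * exp (s * norm (X \<omega>)))) \<longrightarrow>
        measure M {\<omega> \<in> space M. cond_exp_given M Z X \<omega> = 0} < 1 \<longrightarrow>
        (\<exists>p0\<ge>1. \<forall>p>p0.
           (let A = {\<gamma> \<in> unit_sphere p.
              AE \<omega> in M. cond_exp_given M Z (\<lambda>\<omega>. inner (X \<omega>) (from_coords \<rho> p \<gamma>)) \<omega> = 0}
            in A \<in> null_sets (sphere_lebesgue p) \<and> \<not> dense_in_sphere p A)))"
proof -
  note M = assms(1) and X = assms(2) and Z = assms(4) and mean = assms(5) and \<rho> = assms(6)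
  interpret prob_space M
    by (fact M)
  let ?full = "AE \<omega> in M. cond_exp_given M Z X \<omega> = 0"
  let ?direction = "\<lambda>\<beta>. AE \<omega> in M. cond_exp_given M Z (\<lambda>\<omega>. inner (X \<omega>) \<beta>) \<omega> = 0"
  let ?trunc = "\<lambda>p. AE \<omega> in M. cond_exp_given M Z (\<lambda>\<omega>. truncation \<rho> p (X \<omega>)) \<omega> = 0"
  have inner_measurable: "(\<lambda>x. inner x \<beta>) \<in> borel_measurable borel" for \<beta> :: L2_unit
    by (intro borel_measurable_continuous_onI continuous_intros)
  have trunc_measurable: "truncation \<rho> p \<in> borel_measurable borel" for p
    unfolding truncation_def by (intro borel_measurable_continuous_onI continuous_intros)
  have full_direction: "?direction \<beta>" if ?full for \<beta>
    by (rule cond_exp_given_comp_eq_0[OF M X Z that inner_measurable])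
  have full_trunc: "?trunc p" if ?full for p
    by (rule cond_exp_given_comp_eq_0[OF M X Z that trunc_measurable])
  have sphere_full: ?full if "\<forall>p\<ge>1. \<forall>\<gamma>\<in>unit_sphere p. ?direction (from_coords \<rho> p \<gamma>)"
    using that by (intro cond_exp_given_eq_0_if_sphere[OF M X Z mean \<rho>]) auto
  have trunc_direction: "?direction (from_coords \<rho> p \<gamma>)" if "?trunc p" for p \<gamma>
  proof -
    have "inner (truncation \<rho> p x) (from_coords \<rho> p \<gamma>) = inner x (from_coords \<rho> p \<gamma>)" for x
      by (simp add: inner_from_coords inner_truncation[OF \<rho>])
    moreover have "AE \<omega> in M.
        cond_exp_given M Z (\<lambda>\<omega>. inner (truncation \<rho> p (X \<omega>)) (from_coords \<rho> p \<gamma>)) \<omega> = 0"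
      by (rule cond_exp_given_comp_eq_0[OF M measurable_compose[OF X trunc_measurable] Z that
            inner_measurable])
    ultimately show ?thesis
      by simp
  qed
  have "norm (from_coords \<rho> p \<gamma>) = 1" if "\<gamma> \<in> unit_sphere p" for p \<gamma>
    using that norm_from_coords[OF \<rho>] by (simp add: unit_sphere_def)
  then have equiv_directions: "?full \<longleftrightarrow> (\<forall>\<beta>. norm \<beta> = 1 \<longrightarrow> ?direction \<beta>)"
    using full_direction sphere_full by blast
  have equiv_sphere: "?full \<longleftrightarrow> (\<forall>p\<ge>1. \<forall>\<gamma>\<in>unit_sphere p. ?direction (from_coords \<rho> p \<gamma>))"
    using full_direction sphere_full by blast
  have equiv_trunc: "?full \<longleftrightarrow> (\<forall>p\<ge>1. ?trunc p)"
    using full_trunc trunc_direction sphere_full by blast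
  have "\<exists>p0\<ge>1. \<forall>p>p0. (let A = {\<gamma> \<in> unit_sphere p. ?direction (from_coords \<rho> p \<gamma>)}
      in A \<in> null_sets (sphere_lebesgue p) \<and> \<not> dense_in_sphere p A)"
    if exp: "\<forall>s>0. integrable M (\<lambda>\<omega>. \<bar>Z \<omega>\<bar> * exp (s * norm (X \<omega>)))"
      and less: "measure M {\<omega> \<in> space M. cond_exp_given M Z X \<omega> = 0} < 1"
  proof -
    have "\<not> ?full"
    proof
      assume ?full
      then have "measure M {\<omega> \<in> space M. cond_exp_given M Z X \<omega> = 0} = measure M (space M)"
        by (intro measure_eq_AE) (auto simp: cond_exp_given_def)
      with less show False
        by (simp add: prob_space)
    qed
    then obtain p0 \<gamma>0 where "1 \<le> p0" and "\<gamma>0 \<in> unit_sphere p0"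
      and "\<not> ?direction (from_coords \<rho> p0 \<gamma>0)"
      using equiv_sphere by blast
    then show ?thesis
      using cond_exp_given_eq_0_directions_negligible[OF M exp[rule_format] Z X]
      by (auto simp: Let_def intro!: exI[of _ p0])
  qed
  with equiv_directions equiv_sphere equiv_trunc show ?thesis
    by blast
qed

end
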